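(* Let $A$ be an integer matrix with $n$ columns such that $\operatorname{Ker}_{\mathbb Z}(A)\cap\mathbb N^n=\{\mathbf 0\}$ and the toric ideal $I_A$ has codimension $2$ (i.e. $A$ has rank $n-2$). Then $I_A$ is robust if and only if it is strongly robust.
   Context: $K$ is a field. $\operatorname{Ker}_{\mathbb Z}(A)=\{\mathbf u\in\mathbb Z^n: A\mathbf u=0\}$, and the toric ideal $I_A\subset K[x_1,\dots,x_n]$ is generated by the binomials $x^{\mathbf u^+}-x^{\mathbf u^-}$, $\mathbf u\in\operatorname{Ker}_{\mathbb Z}(A)$, where $\mathbf u=\mathbf u^+-\mathbf u^-$ with $\mathbf u^\pm\in\mathbb N^n$ of disjoint supports. The universal Gröbner basis of $I_A$ is the union of all its reduced Gröbner bases. A binomial $x^{\mathbf u^+}-x^{\mathbf u^-}\in I_A$ is primitive if there is no other binomial $x^{\mathbf v^+}-x^{\mathbf v^-}\in I_A$ with $x^{\mathbf v^+}\mid x^{\mathbf u^+}$ and $x^{\mathbf v^-}\mid x^{\mathbf u^-}$ (here $\mathbf u,\mathbf v\neq\mathbf 0$); the Graver basis of $I_A$ is the set of primitive binomials. Binomials are identified with their opposites in these sets. $I_A$ is robust if its universal Gröbner basis is a minimal generating set of $I_A$, and strongly robust if its Graver basis is a minimal generating set of $I_A$. *)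

theory Defs
  imports "HOL-Analysis.Analysis" "HOL-Library.Poly_Mapping"
begin

text \<open>Polynomials in the variables indexed by \<^typ>\<open>'n::finite\<close> with coefficients in \<^typ>\<open>'k\<close>:
  finitely supported functions on exponent vectors, multiplied by convolution.\<close>

type_synonym ('n, 'k) mpoly = "(nat ^ 'n) \<Rightarrow>\<^sub>0 'k"

definition mon :: "nat ^ 'n \<Rightarrow> ('n::finite, 'k::field) mpoly"
  where "mon a = Poly_Mapping.single a 1"

text \<open>A commutative ring is a module over itself; \<open>ideal.subspace\<close> is the predicate of being an
  ideal and \<open>ideal.span\<close> is the ideal generated by a set.\<close>

global_interpretation ideal: module "(*) :: 'a::comm_ring_1 \<Rightarrow> 'a \<Rightarrow> 'a"
  by standard (simp_all add: algebra_simps)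


subsection \<open>Toric ideals\<close>

definition int_kernel :: "int ^ 'n ^ 'm \<Rightarrow> (int ^ 'n) set"
  where "int_kernel A = {u. A *v u = 0}"

definition pos_part :: "int ^ 'n \<Rightarrow> nat ^ 'n"
  where "pos_part u = (\<chi> i. nat (u $ i))"

definition neg_part :: "int ^ 'n \<Rightarrow> nat ^ 'n"
  where "neg_part u = (\<chi> i. nat (- u $ i))"

definition binom :: "int ^ 'n \<Rightarrow> ('n::finite, 'k::field) mpoly"
  where "binom u = mon (pos_part u) - mon (neg_part u)"

definition toric_ideal :: "int ^ 'n ^ 'm \<Rightarrow> ('n::finite, 'k::field) mpoly set"
  where "toric_ideal A = ideal.span (binom ` int_kernel A)"


subsection \<open>Groebner bases\<close>

definition monomial_order :: "(nat ^ 'n) rel \<Rightarrow> bool"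
  where "monomial_order r \<longleftrightarrow> linear_order r \<and> (\<forall>a. (0, a) \<in> r) \<and>
    (\<forall>a b c. (a, b) \<in> r \<longrightarrow> (a + c, b + c) \<in> r)"

text \<open>The exponent of the leading monomial; meaningful only for nonzero polynomials.\<close>

definition lead_exp :: "(nat ^ 'n) rel \<Rightarrow> ('n::finite, 'k::field) mpoly \<Rightarrow> nat ^ 'n"
  where "lead_exp r f = (THE a. a \<in> Poly_Mapping.keys f \<and> (\<forall>b \<in> Poly_Mapping.keys f. (b, a) \<in> r))"

definition initial_ideal :: "(nat ^ 'n) rel \<Rightarrow> ('n::finite, 'k::field) mpoly set \<Rightarrow> ('n, 'k) mpoly set"
  where "initial_ideal r S = ideal.span {mon (lead_exp r f) | f. f \<in> S \<and> f \<noteq> 0}"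

definition groebner_basis ::
    "(nat ^ 'n) rel \<Rightarrow> ('n::finite, 'k::field) mpoly set \<Rightarrow> ('n, 'k) mpoly set \<Rightarrow> bool"
  where "groebner_basis r I G \<longleftrightarrow> finite G \<and> G \<subseteq> I \<and> initial_ideal r G = initial_ideal r I"

text \<open>The condition on the leading coefficient excludes \<open>0\<close> from a reduced basis.\<close>

definition reduced_groebner_basis ::
    "(nat ^ 'n) rel \<Rightarrow> ('n::finite, 'k::field) mpoly set \<Rightarrow> ('n, 'k) mpoly set \<Rightarrow> bool"
  where "reduced_groebner_basis r I G \<longleftrightarrow> groebner_basis r I G \<and>
    (\<forall>g \<in> G. Poly_Mapping.lookup g (lead_exp r g) = 1 \<and>
      (\<forall>a \<in> Poly_Mapping.keys g. mon a \<notin> initial_ideal r (G - {g})))"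

definition universal_groebner_basis :: "('n::finite, 'k::field) mpoly set \<Rightarrow> ('n, 'k) mpoly set"
  where "universal_groebner_basis I = \<Union> {G. \<exists>r. monomial_order r \<and> reduced_groebner_basis r I G}"


subsection \<open>Graver bases\<close>

definition primitive :: "('n::finite, 'k::field) mpoly set \<Rightarrow> int ^ 'n \<Rightarrow> bool"
  where "primitive I u \<longleftrightarrow> u \<noteq> 0 \<and> (binom u :: ('n, 'k) mpoly) \<in> I \<and>
    \<not> (\<exists>v. v \<noteq> 0 \<and> v \<noteq> u \<and> (binom v :: ('n, 'k) mpoly) \<in> I \<and>
        (mon (pos_part v) :: ('n, 'k) mpoly) dvd mon (pos_part u) \<and>
        (mon (neg_part v) :: ('n, 'k) mpoly) dvd mon (neg_part u))"

definition graver_basis :: "('n::finite, 'k::field) mpoly set \<Rightarrow> ('n, 'k) mpoly set"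
  where "graver_basis I = binom ` {u. primitive I u}"


subsection \<open>Robustness\<close>

text \<open>Polynomials are identified with their opposites: a set of polynomials up to sign is represented
  by the set of the classes \<open>{f, - f}\<close>. This is essential for minimality, as the sets
  \<^const>\<open>universal_groebner_basis\<close> and \<^const>\<open>graver_basis\<close> may contain both of \<open>f\<close> and \<open>- f\<close>.\<close>

definition up_to_sign :: "('n::finite, 'k::field) mpoly set \<Rightarrow> ('n, 'k) mpoly set set"
  where "up_to_sign S = (\<lambda>f. {f, - f}) ` S"

definition minimal_generating_set ::
    "('n::finite, 'k::field) mpoly set \<Rightarrow> ('n, 'k) mpoly set set \<Rightarrow> bool"
  where "minimal_generating_set I C \<longleftrightarrow>
    ideal.span (\<Union> C) = I \<and> (\<forall>D. D \<subset> C \<longrightarrow> ideal.span (\<Union> D) \<noteq> I)"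

definition robust :: "('n::finite, 'k::field) mpoly set \<Rightarrow> bool"
  where "robust I \<longleftrightarrow> minimal_generating_set I (up_to_sign (universal_groebner_basis I))"

definition strongly_robust :: "('n::finite, 'k::field) mpoly set \<Rightarrow> bool"
  where "strongly_robust I \<longleftrightarrow> minimal_generating_set I (up_to_sign (graver_basis I))"

end

theory Submission
  imports Defs
begin

text \<open>
  Let \<open>L\<close> be the lattice of integer vectors in the kernel of \<open>A\<close>, and
  \<open>I\<close> its ideal. Two monomials are congruent modulo \<open>I\<close> exactly when their
  exponents differ by a vector of \<open>L\<close>. For a monomial order call an exponent standard if it is
  the least one of its class, and a corner if it is minimal among the nonstandard ones. The reduced Groebner
  basis of \<open>I\<close> then consists of the binomials \<open>x\<^sup>a - x\<^sup>b\<close> with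
  \<open>a\<close> a corner and \<open>b\<close> the standard exponent congruent to it
  (\<open>reduced_groebner_basis_unique\<close>), and such a binomial is primitive. So the universal
  Groebner basis is a generating set inside the Graver basis; if the latter is minimal as a generating set,
  both agree up to sign, and \<open>I\<close> is robust.

  Conversely let \<open>I\<close> be robust. Each reduced Groebner basis already generates, so by minimality
  they all coincide up to sign, with one finite set \<open>M = - M\<close> of vectors. This has two
  consequences. First, for every monomial order and every nonzero \<open>h\<close> in \<open>L\<close> the
  larger of the two monomials of \<open>h\<close> is divisible by the larger monomial of some
  \<open>g\<close> in \<open>M\<close>. Second, no monomial of a vector of \<open>M\<close> divides a
  monomial of another one. The orders at our disposal are plentiful: a subset of \<open>L\<close> that is
  closed under addition and omits \<open>0\<close> can be made positive, because \<open>L\<close> meets the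
  positive orthant only in \<open>0\<close> (\<open>exists_monomial_order\<close>). What remains is to show
  that a primitive vector \<open>h\<close> lies in \<open>M\<close>, and here the rank of \<open>L\<close>
  enters. A nonzero two-by-two minor orients the plane spanned by \<open>L\<close>, and the line through
  \<open>h\<close> divides it into a left and a right half. Let \<open>K\<^sub>-\<close>, resp.
  \<open>K\<^sub>+\<close>, be the cone of the vectors in \<open>L\<close> that are \<open>\<le> 0\<close>
  where \<open>h\<close> is, resp. \<open>\<ge> 0\<close> where \<open>h\<close> is. Thus \<open>g\<^sup>+
  \<le> h\<^sup>+\<close> says that \<open>g\<close> lies in \<open>K\<^sub>-\<close> and \<open>h -
  g\<close> in \<open>K\<^sub>+\<close>, and primitivity says that \<open>h\<close> is irreducible in the
  intersection of the two cones. In each half every sign condition is constant or bounds a slope, so one of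
  the two cones contains the other there (\<open>cones_nested\<close>).

  If the inclusions go in opposite directions, say \<open>K\<^sub>-\<close> is the smaller cone on the left
  and \<open>K\<^sub>+\<close> on the right, then a \<open>g\<close> on the left with \<open>g\<^sup>+ \<le>
  h\<^sup>+\<close> would split \<open>h\<close> inside the intersection. In an order for which the left
  half is positive, the only possible reducer of \<open>h\<close> is therefore \<open>h\<close> itself
  (\<open>mixed_cone\<close>).

  Otherwise one cone contains the other; up to replacing \<open>h\<close> by \<open>- h\<close>,
  \<open>K\<^sub>-\<close> is the smaller one (\<open>nested_cone\<close>). As \<open>h\<close> is
  irreducible in \<open>K\<^sub>-\<close>, it lies on the boundary of the convex hull of the nonzero lattice
  points of \<open>K\<^sub>-\<close> (\<open>no_lattice_triangle\<close>). Suppose that \<open>h\<close> is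
  not in \<open>M\<close>. The \<open>f\<close> in \<open>M\<close> with \<open>f\<^sup>- \<le>
  h\<^sup>-\<close> satisfy \<open>h - f \<in> K\<^sub>-\<close>, so they lie in a closed half-plane that
  avoids \<open>h\<close>. The possible reducers of \<open>- h\<close> are the vectors \<open>- f\<close>,
  in the opposite half-plane. An order for which the side of \<open>- h\<close> is positive still provides
  one, which must lie on the boundary line. This yields \<open>e\<close> with both \<open>e\<close> and
  \<open>- e\<close> among those \<open>f\<close>, so that the boundary of the hull at \<open>h\<close> is
  an edge in direction \<open>e\<close>. Let \<open>v = h - k e\<close> be the last lattice point of this
  edge. An order for which \<open>v\<close> and \<open>e\<close> are negative forces \<open>- v\<close> into
  \<open>M\<close>; but \<open>e\<^sup>+ \<le> v\<^sup>-\<close>, contrary to the second property of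
  \<open>M\<close>.
\<close>


section \<open>Exponent vectors and monomial orders\<close>

lemma pos_part_le_iff: "pos_part g \<le> pos_part h \<longleftrightarrow> (\<forall>i. g $ i \<le> max 0 (h $ i))"
proof -
  have "nat a \<le> nat b \<longleftrightarrow> a \<le> max 0 b" for a b :: int by linarith
  then show ?thesis by (simp add: pos_part_def less_eq_vec_def)
qed

lemma neg_part_eq: "neg_part u = pos_part (- u)"
  by (simp add: neg_part_def pos_part_def)

definition ivec :: "nat ^ 'n \<Rightarrow> int ^ 'n"
  where "ivec a = (\<chi> i. int (a $ i))"

lemma ivec_nth [simp]: "ivec a $ i = int (a $ i)"
  by (simp add: ivec_def)

lemma ivec_add: "ivec (a + b) = ivec a + ivec b"
  by (simp add: vec_eq_iff)

lemma ivec_zero: "ivec 0 = 0"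
  by (simp add: vec_eq_iff)

lemma ivec_inject: "ivec a = ivec b \<longleftrightarrow> a = b"
  by (simp add: vec_eq_iff)

lemma parts_diff: "ivec (pos_part u) - ivec (neg_part u) = u"
  by (simp add: vec_eq_iff pos_part_def neg_part_def)

lemma parts_neq: "u \<noteq> 0 \<Longrightarrow> pos_part u \<noteq> neg_part u"
  by (metis diff_self parts_diff)

lemma le_imp_eq_add:
  fixes a b :: "nat ^ 'n"
  assumes "a \<le> b" obtains c where "b = a + c"
proof
  show "b = a + (\<chi> i. b $ i - a $ i)"
    using assms by (simp add: vec_eq_iff less_eq_vec_def)
qed

lemma le_add_vec: "(a :: nat ^ 'n) \<le> a + c"
  by (simp add: less_eq_vec_def)

text \<open>Of the two kinds of monotone subsequences the nonincreasing ones are eventually constant.\<close>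

lemma nondecreasing_subsequence:
  fixes s :: "nat \<Rightarrow> nat"
  shows "\<exists>f. strict_mono f \<and> incseq (s \<circ> f)"
proof -
  obtain f where f: "strict_mono f" "monoseq (\<lambda>n. s (f n))" using seq_monosub[of s] by (auto simp: o_def)
  then consider "incseq (\<lambda>n. s (f n))" | "decseq (\<lambda>n. s (f n))" using monoseq_iff by blast
  then show ?thesis
  proof cases
    case 1
    then show ?thesis using f by (auto simp: o_def)
  next
    case 2
    \<comment> \<open>From the first index at which a nonincreasing sequence attains its least value, it is constant.\<close>
    define m where "m = (LEAST x. x \<in> range (\<lambda>n. s (f n)))"
    have "m \<in> range (\<lambda>n. s (f n))" unfolding m_def by (rule LeastI_ex) blast
    then obtain N where N: "m = s (f N)" by blast
    have "m \<le> s (f n)" for n unfolding m_def by (rule Least_le) blast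
    moreover have "s (f (n + N)) \<le> m" for n using 2 N by (simp add: decseq_def)
    ultimately have "s (f (n + N)) = m" for n using le_antisym by blast
    then have "incseq (s \<circ> (\<lambda>n. f (n + N)))" by (simp add: incseq_def)
    moreover have "strict_mono (\<lambda>n. f (n + N))" using f(1) by (simp add: strict_mono_def)
    ultimately show ?thesis by blast
  qed
qed

text \<open>Dickson's lemma: thinning the sequence out for one coordinate after the other makes all
  coordinates nondecreasing.\<close>

lemma dickson:
  fixes s :: "nat \<Rightarrow> nat ^ 'n::finite"
  shows "\<exists>i j. i < j \<and> s i \<le> s j"
proof -
  have sub: "\<exists>f. strict_mono f \<and> (\<forall>i \<in> I. incseq (\<lambda>n. s (f n) $ i))" if "finite I" for I
    using that
  proof induction
    case empty
    show ?case by (auto intro: exI[of _ id] simp: strict_mono_def)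
  next
    case (insert i I)
    then obtain f where f: "strict_mono f" "\<forall>i \<in> I. incseq (\<lambda>n. s (f n) $ i)" by blast
    obtain g where g: "strict_mono g" "incseq ((\<lambda>n. s (f n) $ i) \<circ> g)"
      using nondecreasing_subsequence by blast
    have "strict_mono (f \<circ> g)" using f(1) g(1) by (simp add: strict_mono_def)
    moreover have "incseq (\<lambda>n. s ((f \<circ> g) n) $ j)" if "j \<in> insert i I" for j
    proof (cases "j = i")
      case True
      then show ?thesis using g(2) by (simp add: o_def)
    next
      case False
      then have "incseq (\<lambda>n. s (f n) $ j)" using f(2) that by blast
      moreover have "mono g" using g(1) by (rule strict_mono_mono)
      ultimately show ?thesis unfolding incseq_def comp_apply by (blast dest: monoD)
    qed
    ultimately show ?case by blast
  qed
  obtain f where f: "strict_mono f" "\<forall>i \<in> UNIV. incseq (\<lambda>n. s (f n) $ i)"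
    using sub[OF finite_class.finite_UNIV] by (elim exE conjE)
  have "s (f 0) $ i \<le> s (f 1) $ i" for i
    using f(2) incseqD[of "\<lambda>n. s (f n) $ i" 0 1] by simp
  then have "s (f 0) \<le> s (f 1)" by (simp add: less_eq_vec_def)
  moreover have "f 0 < f 1" using f(1) by (simp add: strict_mono_def)
  ultimately show ?thesis by blast
qed

lemma finite_antichain:
  fixes S :: "(nat ^ 'n::finite) set"
  assumes "\<And>a b. \<lbrakk>a \<in> S; b \<in> S; a \<le> b\<rbrakk> \<Longrightarrow> a = b"
  shows "finite S"
proof (rule ccontr)
  assume "infinite S"
  then obtain s :: "nat \<Rightarrow> nat ^ 'n" where s: "inj s" "range s \<subseteq> S"
    using infinite_countable_subset by blast
  obtain i j where "i < j" "s i \<le> s j" using dickson by blast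
  then show False using assms s by (metis injD nat_neq_iff rangeI subsetD)
qed

lemma minimal_below:
  fixes a :: "nat ^ 'n::finite"
  assumes "P a"
  shows "\<exists>b \<le> a. P b \<and> (\<forall>c \<le> b. P c \<longrightarrow> c = b)"
  using assms
proof (induction "\<Sum>i\<in>UNIV. a $ i" arbitrary: a rule: less_induct)
  case less
  show ?case
  proof (cases "\<forall>c \<le> a. P c \<longrightarrow> c = a")
    case True
    then show ?thesis using less.prems by blast
  next
    case False
    then obtain c where c: "c \<le> a" "P c" "c \<noteq> a" by blast
    then obtain i where "c $ i \<noteq> a $ i" by (auto simp: vec_eq_iff)
    then have "(\<Sum>i\<in>UNIV. c $ i) < (\<Sum>i\<in>UNIV. a $ i)"
      using c(1) by (intro sum_strict_mono_ex1) (auto simp: less_eq_vec_def le_less)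
    then obtain b where "b \<le> c" "P b" "\<forall>d \<le> b. P d \<longrightarrow> d = b" using less.hyps c(2) by blast
    then show ?thesis using c(1) order_trans by blast
  qed
qed

locale mon_order =
  fixes r :: "(nat ^ 'n::finite) rel"
  assumes order: "monomial_order r"
begin

lemma r_zero: "(0, a) \<in> r"
  and r_add: "(a, b) \<in> r \<Longrightarrow> (a + c, b + c) \<in> r"
  and r_total: "(a, b) \<in> r \<or> (b, a) \<in> r"
  and r_antisym: "\<lbrakk>(a, b) \<in> r; (b, a) \<in> r\<rbrakk> \<Longrightarrow> a = b"
  and r_trans: "\<lbrakk>(a, b) \<in> r; (b, c) \<in> r\<rbrakk> \<Longrightarrow> (a, c) \<in> r"
proof -
  have "linear_order r" using order by (simp add: monomial_order_def)
  then have *: "refl r" "trans r" "antisym r" "total r"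
    by (auto simp: linear_order_on_def partial_order_on_def preorder_on_def)
  show "(a, b) \<in> r \<or> (b, a) \<in> r" using *(1,4) by (metis UNIV_I refl_onD total_on_def)
  show "\<lbrakk>(a, b) \<in> r; (b, a) \<in> r\<rbrakk> \<Longrightarrow> a = b" using *(3) by (blast dest: antisymD)
  show "\<lbrakk>(a, b) \<in> r; (b, c) \<in> r\<rbrakk> \<Longrightarrow> (a, c) \<in> r" using *(2) by (blast dest: transD)
qed (use order in \<open>auto simp: monomial_order_def\<close>)

lemma r_refl: "(a, a) \<in> r"
  using r_total by blast

lemma r_cancel:
  assumes "(a + c, b + c) \<in> r" shows "(a, b) \<in> r"
  using r_total[of a b] r_add[of b a c] r_antisym assms by fastforce

lemma r_le:
  assumes "a \<le> b" shows "(a, b) \<in> r"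
proof -
  obtain c where c: "b = a + c" using le_imp_eq_add[OF assms] .
  show ?thesis using r_add[OF r_zero, of a c] unfolding c add.commute[of a c] by simp
qed

text \<open>In an infinite descent some exponent divides a later one by Dickson's lemma, and so lies below it in
  every monomial order.\<close>

lemma wf_r: "wf (r - Id)"
proof (rule ccontr)
  assume "\<not> ?thesis"
  then obtain s where s: "\<And>i. (s (Suc i), s i) \<in> r - Id" unfolding wf_iff_no_infinite_down_chain by blast
  obtain i j where ij: "i < j" "s i \<le> s j" using dickson by blast
  have "Suc i \<le> j" using ij(1) by simp
  then have "(s j, s (Suc i)) \<in> r"
  proof (induction j rule: dec_induct)
    case (step n)
    then show ?case using s[of n] r_trans[of "s (Suc n)" "s n"] by blast
  qed (rule r_refl)
  then have "(s i, s (Suc i)) \<in> r" using r_le[OF ij(2)] r_trans by blast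
  then show False using s[of i] r_antisym by blast
qed

lemma r_min:
  assumes "a \<in> S"
  obtains b where "b \<in> S" "\<And>c. c \<in> S \<Longrightarrow> (b, c) \<in> r"
proof -
  obtain b where b: "b \<in> S" "\<And>c. (c, b) \<in> r - Id \<Longrightarrow> c \<notin> S" using wfE_min[OF wf_r assms] by blast
  have "(b, c) \<in> r" if "c \<in> S" for c
    using b(2)[of c] r_total[of b c] r_refl that by auto
  then show ?thesis using that b(1) by blast
qed

lemma r_max:
  assumes "finite S" "S \<noteq> {}"
  shows "\<exists>a \<in> S. \<forall>b \<in> S. (b, a) \<in> r"
  using assms
proof (induction rule: finite_ne_induct)
  case (insert x F)
  then show ?case using r_total r_trans r_refl by (metis insert_iff)
qed (simp add: r_refl)

end

section \<open>Monomials, binomials and leading exponents\<close>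

lemma poly_mapping_add_induct [case_names zero single add]:
  fixes f :: "'a \<Rightarrow>\<^sub>0 'b::comm_monoid_add"
  assumes "P 0" "\<And>a c. P (Poly_Mapping.single a c)" "\<And>f g. P f \<Longrightarrow> P g \<Longrightarrow> P (f + g)"
  shows "P f"
proof (induction f rule: update_induct)
  case (update f a b)
  have "Poly_Mapping.update a b f = f + Poly_Mapping.single a b"
    using update(1) by (intro poly_mapping_eqI)
      (auto simp: lookup_update lookup_add lookup_single when_def in_keys_iff)
  then show ?case using assms update by metis
qed (rule assms)

lemma mon_mult: "mon a * mon b = (mon (a + b) :: ('n::finite, 'k::field) mpoly)"
  by (simp add: mon_def mult_single)

lemma mon_dvd_iff: "(mon a :: ('n::finite, 'k::field) mpoly) dvd mon b \<longleftrightarrow> a \<le> b"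
proof
  assume "(mon a :: ('n, 'k) mpoly) dvd mon b"
  then obtain f :: "('n, 'k) mpoly" where f: "mon b = mon a * f" by blast
  have "b \<in> Poly_Mapping.keys (mon b :: ('n, 'k) mpoly)" by (simp add: mon_def)
  then have "b \<in> Poly_Mapping.keys (mon a * f)" unfolding f .
  then obtain c where "b = a + c" using keys_mult[of "mon a" f] by (auto simp: mon_def)
  then show "a \<le> b" by (simp add: le_add_vec)
next
  assume "a \<le> b"
  then obtain c where "b = a + c" by (rule le_imp_eq_add)
  then show "(mon a :: ('n, 'k) mpoly) dvd mon b" by (simp flip: mon_mult)
qed

text \<open>The polynomials all of whose exponents lie above some element of \<open>B\<close> form an ideal.\<close>

lemma mon_in_monomial_ideal:
  "(mon a :: ('n::finite, 'k::field) mpoly) \<in> ideal.span (mon ` B) \<longleftrightarrow> (\<exists>b \<in> B. b \<le> a)"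
proof
  define J where "J = {f :: ('n, 'k) mpoly. \<forall>a \<in> Poly_Mapping.keys f. \<exists>b \<in> B. b \<le> a}"
  have "ideal.subspace J"
  proof (rule ideal.subspaceI)
    show "f + g \<in> J" if "f \<in> J" "g \<in> J" for f g
      using that keys_add[of f g] unfolding J_def by blast
    show "f * g \<in> J" if "g \<in> J" for f g
    proof -
      have "\<exists>b \<in> B. b \<le> c + d" if d: "d \<in> Poly_Mapping.keys g" for c d
      proof -
        obtain b where "b \<in> B" "b \<le> d" using \<open>g \<in> J\<close> d unfolding J_def by blast
        moreover have "d \<le> c + d" by (simp add: less_eq_vec_def)
        ultimately show ?thesis using order_trans by blast
      qed
      moreover have "\<exists>c d. a = c + d \<and> d \<in> Poly_Mapping.keys g" if "a \<in> Poly_Mapping.keys (f * g)" for a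
        using keys_mult[of f g] that by blast
      ultimately show ?thesis unfolding J_def by blast
    qed
  qed (simp add: J_def)
  moreover have "mon ` B \<subseteq> J" by (auto simp: J_def mon_def)
  ultimately have "ideal.span (mon ` B) \<subseteq> J" by (intro ideal.span_minimal)
  moreover assume "(mon a :: ('n, 'k) mpoly) \<in> ideal.span (mon ` B)"
  ultimately show "\<exists>b \<in> B. b \<le> a" by (auto simp: J_def mon_def)
next
  assume "\<exists>b \<in> B. b \<le> a"
  then obtain b where b: "b \<in> B" "b \<le> a" by blast
  then obtain c where c: "a = b + c" using le_imp_eq_add by blast
  have "mon c * mon b \<in> (ideal.span (mon ` B) :: ('n, 'k) mpoly set)"
    using b by (intro ideal.span_scale ideal.span_base) simp
  then show "(mon a :: ('n, 'k) mpoly) \<in> ideal.span (mon ` B)"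
    unfolding c by (simp add: mon_mult add.commute)
qed

lemma keys_mon_diff:
  assumes "a \<noteq> b"
  shows "Poly_Mapping.keys (mon a - mon b :: ('n::finite, 'k::field) mpoly) = {a, b}"
  using assms by (auto simp: in_keys_iff mon_def lookup_minus lookup_single when_def split: if_splits)

lemma mon_diff_eq:
  fixes f :: "('n::finite, 'k::field) mpoly"
  assumes "Poly_Mapping.keys f = {a, b}" "a \<noteq> b" "Poly_Mapping.lookup f a = 1" "Poly_Mapping.lookup f b = - 1"
  shows "f = mon a - mon b"
proof (rule poly_mapping_eqI)
  fix c
  have "Poly_Mapping.lookup f c = 0" if "c \<noteq> a" "c \<noteq> b"
    using assms(1) that by (metis in_keys_iff insert_iff singletonD)
  then show "Poly_Mapping.lookup f c = Poly_Mapping.lookup (mon a - mon b) c"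
    using assms(2-4) by (auto simp: mon_def lookup_minus lookup_single when_def)
qed

lemma keys_binom:
  assumes "u \<noteq> 0"
  shows "Poly_Mapping.keys (binom u :: ('n::finite, 'k::field) mpoly) = {pos_part u, neg_part u}"
  unfolding binom_def using keys_mon_diff[OF parts_neq[OF assms]] .

lemma binom_uminus: "binom (- u) = - (binom u :: ('n::finite, 'k::field) mpoly)"
  by (simp add: binom_def neg_part_eq)

lemma binom_nonzero: "u \<noteq> 0 \<Longrightarrow> (binom u :: ('n::finite, 'k::field) mpoly) \<noteq> 0"
  using keys_binom[of u] by (metis insert_not_empty keys_zero)

context mon_order
begin

lemma lead_exp_eq:
  assumes "a \<in> Poly_Mapping.keys f" "\<And>b. b \<in> Poly_Mapping.keys f \<Longrightarrow> (b, a) \<in> r"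
  shows "lead_exp r f = a"
  unfolding lead_exp_def
proof (rule the_equality)
  fix c assume "c \<in> Poly_Mapping.keys f \<and> (\<forall>b \<in> Poly_Mapping.keys f. (b, c) \<in> r)"
  then show "c = a" using assms by (blast intro: r_antisym)
qed (use assms in blast)

lemma
  assumes "f \<noteq> 0"
  shows lead_exp_in_keys: "lead_exp r f \<in> Poly_Mapping.keys f"
    and lead_exp_greatest: "\<And>b. b \<in> Poly_Mapping.keys f \<Longrightarrow> (b, lead_exp r f) \<in> r"
proof -
  obtain a where a: "a \<in> Poly_Mapping.keys f" "\<And>b. b \<in> Poly_Mapping.keys f \<Longrightarrow> (b, a) \<in> r"
    using r_max[of "Poly_Mapping.keys f"] assms by auto
  then have "lead_exp r f = a" by (rule lead_exp_eq)
  then show "lead_exp r f \<in> Poly_Mapping.keys f"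
    "\<And>b. b \<in> Poly_Mapping.keys f \<Longrightarrow> (b, lead_exp r f) \<in> r" using a by auto
qed

lemma mon_in_initial_ideal:
  "mon a \<in> initial_ideal r S \<longleftrightarrow> (\<exists>f \<in> S. f \<noteq> 0 \<and> lead_exp r f \<le> a)"
proof -
  have eq: "{mon (lead_exp r f) | f. f \<in> S \<and> f \<noteq> 0} = mon ` lead_exp r ` {f \<in> S. f \<noteq> 0}" by auto
  show ?thesis unfolding initial_ideal_def eq mon_in_monomial_ideal by auto
qed

end

section \<open>Pointed lattices and their primitive vectors\<close>

locale toric_lattice =
  fixes L :: "(int ^ 'n::finite) set"
  assumes zero_mem: "0 \<in> L"
    and add_mem: "\<lbrakk>u \<in> L; v \<in> L\<rbrakk> \<Longrightarrow> u + v \<in> L"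
    and uminus_mem: "u \<in> L \<Longrightarrow> - u \<in> L"
    and pointed: "\<lbrakk>u \<in> L; \<forall>i. 0 \<le> u $ i\<rbrakk> \<Longrightarrow> u = 0"
begin

lemma diff_mem: "\<lbrakk>u \<in> L; v \<in> L\<rbrakk> \<Longrightarrow> u - v \<in> L"
  using add_mem[OF _ uminus_mem, of u v] by simp

text \<open>The exponent form of the Graver basis, freed from the coefficient field; see \<open>primitive_iff\<close> below.\<close>

definition graver :: "(int ^ 'n) set"
  where "graver = {u \<in> L. u \<noteq> 0 \<and>
    (\<forall>v \<in> L. v \<noteq> 0 \<and> pos_part v \<le> pos_part u \<and> neg_part v \<le> neg_part u \<longrightarrow> v = u)}"

lemma graverD:
  "\<lbrakk>u \<in> graver; v \<in> L; v \<noteq> 0; pos_part v \<le> pos_part u; neg_part v \<le> neg_part u\<rbrakk> \<Longrightarrow> v = u"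
  unfolding graver_def by blast

lemma graver_in: "u \<in> graver \<Longrightarrow> u \<in> L" and graver_nonzero: "u \<in> graver \<Longrightarrow> u \<noteq> 0"
  by (auto simp: graver_def)

lemma graver_uminus:
  assumes "u \<in> graver"
  shows "- u \<in> graver"
proof -
  have "v = - u" if "v \<in> L" "v \<noteq> 0" "pos_part v \<le> pos_part (- u)" "neg_part v \<le> neg_part (- u)" for v
  proof -
    have "- v = u" using graverD[OF assms uminus_mem[OF that(1)]] that by (simp add: neg_part_eq)
    then show ?thesis by auto
  qed
  then show ?thesis using assms uminus_mem by (simp add: graver_def)
qed

lemma has_neg: "\<lbrakk>u \<in> L; u \<noteq> 0\<rbrakk> \<Longrightarrow> \<exists>i. u $ i < 0"
  using pointed[of u] by (meson linorder_not_less)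

lemma has_pos: "\<lbrakk>u \<in> L; u \<noteq> 0\<rbrakk> \<Longrightarrow> \<exists>i. 0 < u $ i"
  using has_neg[of "- u"] uminus_mem by auto

end

section \<open>Monomial orders with prescribed positive vectors\<close>

context toric_lattice
begin

text \<open>Every order of this kind is the restriction of a total group order on the integer vectors, and
  such an order is the same as its cone \<open>P\<close> of nonnegative elements: closed under addition, with
  \<open>P \<inter> - P = {0}\<close> and \<open>P \<union> - P\<close> everything. The cone generated by \<open>C\<close> and the
  nonnegative vectors has the first two properties since \<open>L\<close> is pointed and \<open>C\<close> omits \<open>0\<close>. A maximal cone above it has
  the third: if neither \<open>x\<close> nor \<open>- x\<close> can be adjoined, then some positive multiple of \<open>- x\<close> and some
  positive multiple of \<open>x\<close> are in the cone already, and a common multiple contradicts the second property.\<close>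

lemma exists_monomial_order:
  assumes C: "C \<subseteq> L" "\<And>u v. \<lbrakk>u \<in> C; v \<in> C\<rbrakk> \<Longrightarrow> u + v \<in> C" "0 \<notin> C"
  shows "\<exists>r. monomial_order r \<and> (\<forall>u \<in> C. (neg_part u, pos_part u) \<in> r)"
proof -
  define P0 where "P0 = {u + ivec a | u a. u \<in> insert 0 C}"
  define cone where "cone P \<longleftrightarrow> P0 \<subseteq> P \<and> (\<forall>x\<in>P. \<forall>y\<in>P. x + y \<in> P) \<and>
    (\<forall>x. x \<in> P \<longrightarrow> - x \<in> P \<longrightarrow> x = 0)" for P :: "(int ^ 'n) set"
  have CL: "u \<in> L" if "u \<in> insert 0 C" for u using that C zero_mem by auto
  have C0: "u + v \<in> insert 0 C" if "u \<in> insert 0 C" "v \<in> insert 0 C" for u v using that C by auto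
  have "cone P0"
    unfolding cone_def
  proof (intro conjI ballI allI impI)
    fix x y assume "x \<in> P0" "y \<in> P0"
    then obtain u a v b where "u \<in> insert 0 C" "v \<in> insert 0 C" "x = u + ivec a" "y = v + ivec b"
      unfolding P0_def by blast
    then have "x + y = (u + v) + ivec (a + b)" "u + v \<in> insert 0 C"
      using C0 by (simp_all only: ivec_add algebra_simps)
    then show "x + y \<in> P0" unfolding P0_def by blast
  next
    fix x assume "x \<in> P0" "- x \<in> P0"
    then obtain u a v b where *: "u \<in> insert 0 C" "v \<in> insert 0 C" "x = u + ivec a" "- x = v + ivec b"
      unfolding P0_def by blast
    then have eq: "- (u + v) = ivec (a + b)" by (simp add: ivec_add algebra_simps eq_neg_iff_add_eq_0)
    have "u + v \<in> L" using * CL add_mem by blast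
    moreover have "\<forall>i. 0 \<le> (- (u + v)) $ i" unfolding eq by simp
    ultimately have "- (u + v) = 0" using pointed uminus_mem by blast
    then have uv: "u + v = 0" "ivec (a + b) = 0" using eq by (simp_all only: neg_equal_0_iff_equal)
    then have "u = 0" using C0[of u v] C(3) *(1,2) C(2)[of u v] by auto
    moreover have "a = 0"
    proof -
      have "int (a $ i) + int (b $ i) = 0" for i
        using arg_cong[OF uv(2), of "\<lambda>v. v $ i"] by simp
      then have "a $ i = 0" for i by (metis add_is_0 of_nat_add of_nat_eq_0_iff)
      then show ?thesis by (simp add: vec_eq_iff)
    qed
    ultimately show "x = 0" using * by (simp add: ivec_zero)
  qed simp
  then have "\<exists>P \<in> {P. cone P}. \<forall>X \<in> {P. cone P}. P \<subseteq> X \<longrightarrow> X = P"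
  proof (intro subset_Zorn_nonempty)
    fix \<C> assume ne: "\<C> \<noteq> {}" and ch: "subset.chain {P. cone P} \<C>"
    have co: "cone P" if "P \<in> \<C>" for P using ch that by (auto simp: subset.chain_def)
    have tot: "P \<subseteq> Q \<or> Q \<subseteq> P" if "P \<in> \<C>" "Q \<in> \<C>" for P Q
      using ch that by (auto simp: subset_chain_def)
    have common: "\<exists>P \<in> \<C>. x \<in> P \<and> y \<in> P" if "x \<in> \<Union>\<C>" "y \<in> \<Union>\<C>" for x y
      using that tot by blast
    show "\<Union>\<C> \<in> {P. cone P}"
      unfolding mem_Collect_eq cone_def
    proof (intro conjI ballI allI impI)
      show "P0 \<subseteq> \<Union>\<C>" using ne co unfolding cone_def by blast
      show "x + y \<in> \<Union>\<C>" if "x \<in> \<Union>\<C>" "y \<in> \<Union>\<C>" for x y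
        using common[OF that] co unfolding cone_def by blast
      show "x = 0" if "x \<in> \<Union>\<C>" "- x \<in> \<Union>\<C>" for x
        using common[OF that] co unfolding cone_def by blast
    qed
  qed blast
  then obtain P where P: "cone P" and max: "\<And>X. \<lbrakk>cone X; P \<subseteq> X\<rbrakk> \<Longrightarrow> X = P" by blast
  have P0: "P0 \<subseteq> P" and Padd: "\<And>x y. \<lbrakk>x \<in> P; y \<in> P\<rbrakk> \<Longrightarrow> x + y \<in> P"
    and Ppt: "\<And>x. \<lbrakk>x \<in> P; - x \<in> P\<rbrakk> \<Longrightarrow> x = 0" using P unfolding cone_def by auto
  have iP: "ivec a \<in> P" for a using P0 unfolding P0_def by force
  have CP: "u \<in> P" if "u \<in> C" for u
    using P0 that unfolding P0_def by (force intro: exI[of _ u] exI[of _ 0] simp: ivec_zero)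
  have zP: "0 \<in> P" using iP[of 0] by (simp add: ivec_zero)
  have Pmult: "(\<chi> i. int k * x $ i) \<in> P" if "x \<in> P" for k x
  proof (induction k)
    case 0
    then show ?case using zP by (simp add: zero_vec_def)
  next
    case (Suc k)
    have "(\<chi> i. int (Suc k) * x $ i) = x + (\<chi> i. int k * x $ i)"
      by (simp add: vec_eq_iff algebra_simps)
    then show ?case using Padd that Suc by metis
  qed
  \<comment> \<open>Adjoining \<open>x\<close> to the maximal cone \<open>P\<close> destroys \<open>P \<inter> - P = {0}\<close>, and adding up the two
    representations of the offending element and of its negative leaves a multiple of \<open>- x\<close> in \<open>P\<close>.\<close>
  have absorb: "\<exists>k > 0. (\<chi> i. - int k * x $ i) \<in> P" if x: "x \<notin> P" for x
  proof -
    define X where "X = {y + (\<chi> i. int k * x $ i) | y k. y \<in> P}"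
    have PX: "P \<subseteq> X"
    proof
      fix y assume "y \<in> P"
      moreover have "y = y + (\<chi> i. int 0 * x $ i)" by (simp add: vec_eq_iff)
      ultimately show "y \<in> X" unfolding X_def by blast
    qed
    have "x = 0 + (\<chi> i. int 1 * x $ i)" by (simp add: vec_eq_iff)
    then have "x \<in> X" unfolding X_def using zP by blast
    then have "\<not> cone X" using max PX x by blast
    moreover have "y + z \<in> X" if yz: "y \<in> X" "z \<in> X" for y z
    proof -
      obtain y' k z' l where *: "y' \<in> P" "z' \<in> P" "y = y' + (\<chi> i. int k * x $ i)" "z = z' + (\<chi> i. int l * x $ i)"
        using yz unfolding X_def by blast
      then have "y + z = (y' + z') + (\<chi> i. int (k + l) * x $ i)" by (simp add: vec_eq_iff algebra_simps)
      then show ?thesis unfolding X_def using Padd * by blast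
    qed
    ultimately obtain y where y: "y \<in> X" "- y \<in> X" "y \<noteq> 0" using P0 PX unfolding cone_def by blast
    then obtain y' k z' l where *: "y' \<in> P" "z' \<in> P" "y = y' + (\<chi> i. int k * x $ i)"
      "- y = z' + (\<chi> i. int l * x $ i)" unfolding X_def by blast
    have "(\<chi> i. - int (k + l) * x $ i) = y' + z'"
    proof -
      have "- int (k + l) * x $ i = y' $ i + z' $ i" for i
      proof -
        have "y $ i = y' $ i + int k * x $ i" "- y $ i = z' $ i + int l * x $ i"
          using arg_cong[OF *(3), of "\<lambda>v. v $ i"] arg_cong[OF *(4), of "\<lambda>v. v $ i"] by simp_all
        then show ?thesis unfolding of_nat_add by algebra
      qed
      then show ?thesis by (simp add: vec_eq_iff)
    qed
    then have "(\<chi> i. - int (k + l) * x $ i) \<in> P" using * Padd by metis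
    moreover have "k + l > 0"
    proof (rule ccontr)
      assume "\<not> k + l > 0"
      then have "y = y'" "- y = z'" using * by (simp_all add: vec_eq_iff)
      then show False using y(3) Ppt * by blast
    qed
    ultimately show ?thesis by blast
  qed
  have Ptot: "x \<in> P \<or> - x \<in> P" for x
  proof (rule ccontr)
    assume *: "\<not> ?thesis"
    obtain k where k: "k > 0" "(\<chi> i. - int k * x $ i) \<in> P" using absorb[of x] * by blast
    obtain l where l: "l > 0" "(\<chi> i. - int l * (- x) $ i) \<in> P" using absorb[of "- x"] * by blast
    define z where "z = (\<chi> i. int (k * l) * x $ i)"
    have "(\<chi> i. int l * (\<chi> i. - int k * x $ i) $ i) = - z"
      "(\<chi> i. int k * (\<chi> i. - int l * (- x) $ i) $ i) = z"
      by (simp_all add: z_def vec_eq_iff)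
    then have "- z \<in> P" "z \<in> P" using Pmult[OF k(2), of l] Pmult[OF l(2), of k] by simp_all
    then have "z = 0" using Ppt by blast
    then have "x = 0" using k(1) l(1) by (simp add: z_def vec_eq_iff)
    then show False using * zP by simp
  qed
  define r where "r = {(a, b). ivec b - ivec a \<in> P}"
  have "monomial_order r"
    unfolding monomial_order_def linear_order_on_def partial_order_on_def preorder_on_def
  proof (intro conjI allI impI)
    show "refl r" using zP by (simp add: r_def refl_on_def)
    show "trans r"
    proof (rule transI)
      fix a b c assume "(a, b) \<in> r" "(b, c) \<in> r"
      then have "ivec b - ivec a \<in> P" "ivec c - ivec b \<in> P" by (simp_all add: r_def)
      from Padd[OF this] show "(a, c) \<in> r" by (simp add: r_def)
    qed
    show "antisym r"
    proof (rule antisymI)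
      fix a b assume "(a, b) \<in> r" "(b, a) \<in> r"
      then have "ivec b - ivec a = 0" by (intro Ppt) (simp_all add: r_def)
      then show "a = b" by (simp add: ivec_inject)
    qed
    show "total r"
      unfolding total_on_def
    proof (intro ballI impI)
      fix a b :: "nat ^ 'n"
      show "(a, b) \<in> r \<or> (b, a) \<in> r" using Ptot[of "ivec b - ivec a"] by (simp add: r_def)
    qed
    show "(0, a) \<in> r" for a using iP by (simp add: r_def ivec_zero)
    show "(a + c, b + c) \<in> r" if "(a, b) \<in> r" for a b c using that by (simp add: r_def ivec_add)
  qed (auto simp: Field_def)
  moreover have "(neg_part u, pos_part u) \<in> r" if "u \<in> C" for u
    using CP[OF that] by (simp add: r_def parts_diff)
  ultimately show ?thesis by blast
qed

end

section \<open>Lattice ideals\<close>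

context toric_lattice
begin

abbreviation congruent :: "nat ^ 'n \<Rightarrow> nat ^ 'n \<Rightarrow> bool" (infix "\<sim>" 50)
  where "a \<sim> b \<equiv> ivec a - ivec b \<in> L"

lemma cong_refl: "a \<sim> a"
  using zero_mem by simp

lemma cong_sym: "a \<sim> b \<Longrightarrow> b \<sim> a"
  using uminus_mem[of "ivec a - ivec b"] by simp

lemma cong_trans: "\<lbrakk>a \<sim> b; b \<sim> c\<rbrakk> \<Longrightarrow> a \<sim> c"
  using add_mem[of "ivec a - ivec b" "ivec b - ivec c"] by simp

lemma cong_add: "a + c \<sim> b + c \<longleftrightarrow> a \<sim> b"
  by (simp add: ivec_add)

lemma cong_parts: "pos_part u \<sim> neg_part u \<longleftrightarrow> u \<in> L"
  by (simp add: parts_diff)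

text \<open>The sum of the coefficients over a congruence class is a linear functional. Multiplication by a term only
  moves it to another class, and it vanishes on the generators, hence on the whole ideal.
  The class is given by an integer vector rather than an exponent because moving it back along a term may leave the exponents.\<close>

definition fiber_sum :: "('n, 'k::field) mpoly \<Rightarrow> int ^ 'n \<Rightarrow> 'k"
  where "fiber_sum f z = (\<Sum>b \<in> Poly_Mapping.keys f. if ivec b - z \<in> L then Poly_Mapping.lookup f b else 0)"

lemma fiber_sum_superset:
  assumes "finite S" "Poly_Mapping.keys f \<subseteq> S"
  shows "fiber_sum f z = (\<Sum>b \<in> S. if ivec b - z \<in> L then Poly_Mapping.lookup f b else 0)"
  unfolding fiber_sum_def using assms by (intro sum.mono_neutral_left) (auto simp: in_keys_iff)

lemma fiber_sum_zero: "fiber_sum 0 z = 0"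
  by (simp add: fiber_sum_def)

lemma fiber_sum_add: "fiber_sum (f + g) z = fiber_sum f z + fiber_sum g z"
proof -
  let ?S = "Poly_Mapping.keys f \<union> Poly_Mapping.keys g"
  have "fiber_sum (f + g) z = (\<Sum>b \<in> ?S. if ivec b - z \<in> L then Poly_Mapping.lookup (f + g) b else 0)"
    using keys_add[of f g] by (intro fiber_sum_superset) auto
  also have "\<dots> = fiber_sum f z + fiber_sum g z"
    by (subst (1 2) fiber_sum_superset[of ?S]) (auto simp: lookup_add simp flip: sum.distrib intro!: sum.cong)
  finally show ?thesis .
qed

lemma fiber_sum_single:
  "fiber_sum (Poly_Mapping.single a c) z = (if ivec a - z \<in> L then c else 0)"
  by (subst fiber_sum_superset[of "{a}"]) auto

lemma fiber_sum_single_mult: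
  "fiber_sum (Poly_Mapping.single e c * f) z = c * fiber_sum f (z - ivec e)"
proof (induction f rule: poly_mapping_add_induct)
  case (single a k)
  have eq: "ivec (e + a) - z = ivec a - (z - ivec e)" by (simp add: ivec_add)
  show ?case unfolding mult_single fiber_sum_single eq by simp
qed (simp_all add: fiber_sum_zero fiber_sum_add algebra_simps)

definition lattice_ideal :: "('n, 'k::field) mpoly set"
  where "lattice_ideal = ideal.span (binom ` L)"

lemma fiber_sum_lattice_ideal:
  assumes "f \<in> (lattice_ideal :: ('n, 'k::field) mpoly set)"
  shows "fiber_sum f z = 0"
proof -
  define J where "J = {f :: ('n, 'k) mpoly. \<forall>z. fiber_sum f z = 0}"
  have "ideal.subspace J"
  proof (rule ideal.subspaceI)
    show "p * f \<in> J" if "f \<in> J" for p f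
      using that
      by (induction p rule: poly_mapping_add_induct)
        (auto simp: J_def fiber_sum_zero fiber_sum_add fiber_sum_single_mult distrib_right)
  qed (auto simp: J_def fiber_sum_zero fiber_sum_add)
  moreover have "binom ` L \<subseteq> J"
  proof clarify
    fix u assume u: "u \<in> L"
    have "binom u = Poly_Mapping.single (pos_part u) 1 + Poly_Mapping.single (neg_part u) (- 1 :: 'k)"
      by (simp add: binom_def mon_def single_uminus)
    moreover have "ivec (pos_part u) - z \<in> L \<longleftrightarrow> ivec (neg_part u) - z \<in> L" for z
    proof -
      have "x - z = w + (y - z)" "y - z = (x - z) - w" if "x - y = w" for x y w :: "int ^ 'n"
        by (simp_all flip: that)
      note this[OF parts_diff[of u]]
      then show ?thesis using add_mem[OF u] diff_mem[OF _ u] by metis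
    qed
    ultimately show "binom u \<in> J" by (simp add: J_def fiber_sum_add fiber_sum_single)
  qed
  ultimately have "ideal.span (binom ` L) \<subseteq> J" by (intro ideal.span_minimal)
  then show ?thesis using assms by (auto simp: lattice_ideal_def J_def)
qed

text \<open>A class that meets the support in a single exponent would have a nonzero coefficient sum.\<close>

lemma congruent_key:
  assumes f: "f \<in> (lattice_ideal :: ('n, 'k::field) mpoly set)" and a: "a \<in> Poly_Mapping.keys f"
  shows "\<exists>b \<in> Poly_Mapping.keys f. b \<noteq> a \<and> b \<sim> a"
proof (rule ccontr)
  assume "\<not> ?thesis"
  then have "fiber_sum f (ivec a) = (\<Sum>b \<in> Poly_Mapping.keys f. if b = a then Poly_Mapping.lookup f b else 0)"
    unfolding fiber_sum_def using cong_refl by (intro sum.cong) auto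
  also have "\<dots> = Poly_Mapping.lookup f a" using a by simp
  finally show False using fiber_sum_lattice_ideal[OF f] a by (simp add: in_keys_iff)
qed

lemma binom_in_lattice_ideal: "(binom u :: ('n, 'k::field) mpoly) \<in> lattice_ideal \<longleftrightarrow> u \<in> L"
proof
  assume "u \<in> L"
  then show "(binom u :: ('n, 'k) mpoly) \<in> lattice_ideal"
    unfolding lattice_ideal_def by (intro ideal.span_base imageI)
next
  assume *: "(binom u :: ('n, 'k) mpoly) \<in> lattice_ideal"
  show "u \<in> L"
  proof (cases "u = 0")
    case False
    have "\<exists>b \<in> Poly_Mapping.keys (binom u :: ('n, 'k) mpoly). b \<noteq> pos_part u \<and> b \<sim> pos_part u"
      using False by (intro congruent_key[OF *]) (simp add: keys_binom)
    then have "neg_part u \<sim> pos_part u" using False by (auto simp: keys_binom)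
    then show ?thesis using cong_sym cong_parts by blast
  qed (simp add: zero_mem)
qed

text \<open>Dividing by the greatest common divisor of the two monomials leaves a binomial of coprime monomials.\<close>

lemma mon_diff_in_lattice_ideal:
  assumes "a \<sim> b"
  shows "(mon a - mon b :: ('n, 'k::field) mpoly) \<in> lattice_ideal"
proof -
  define u where "u = ivec a - ivec b"
  define c where "c = (\<chi> i. min (a $ i) (b $ i))"
  have "a = pos_part u + c" "b = neg_part u + c"
    by (auto simp: vec_eq_iff u_def c_def pos_part_def neg_part_def)
  then have "(mon a - mon b :: ('n, 'k) mpoly) = mon c * binom u"
    by (simp add: binom_def right_diff_distrib mon_mult add.commute)
  also have "\<dots> \<in> lattice_ideal"
    unfolding lattice_ideal_def using assms by (intro ideal.span_scale ideal.span_base) (auto simp: u_def)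
  finally show ?thesis .
qed

lemma primitive_iff: "primitive (lattice_ideal :: ('n, 'k::field) mpoly set) u \<longleftrightarrow> u \<in> graver"
  unfolding primitive_def graver_def mon_dvd_iff binom_in_lattice_ideal by blast

end

section \<open>The reduced Groebner basis of a lattice ideal\<close>

locale ordered_lattice = toric_lattice L + mon_order r
  for L :: "(int ^ 'n::finite) set" and r :: "(nat ^ 'n) rel"
begin

definition standard :: "nat ^ 'n \<Rightarrow> bool"
  where "standard a \<longleftrightarrow> (\<forall>b. b \<sim> a \<longrightarrow> (a, b) \<in> r)"

text \<open>The corners are the exponents of the minimal generators of the initial ideal
  (\<open>initial_ideal_lattice_ideal\<close>).\<close>

definition corner :: "nat ^ 'n \<Rightarrow> bool"
  where "corner a \<longleftrightarrow> \<not> standard a \<and> (\<forall>b \<le> a. \<not> standard b \<longrightarrow> b = a)"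

definition reduced_vectors :: "(int ^ 'n) set"
  where "reduced_vectors = {u \<in> L. corner (pos_part u) \<and> standard (neg_part u)}"

lemma standardD: "\<lbrakk>standard a; b \<sim> a\<rbrakk> \<Longrightarrow> (a, b) \<in> r"
  by (simp add: standard_def)

lemma standard_unique: "\<lbrakk>standard a; standard b; a \<sim> b\<rbrakk> \<Longrightarrow> a = b"
  by (meson standardD cong_sym r_antisym)

lemma nonstandardI: "\<lbrakk>b \<sim> a; (b, a) \<in> r; b \<noteq> a\<rbrakk> \<Longrightarrow> \<not> standard a"
  by (meson standardD r_antisym)

lemma standard_in_class: "\<exists>b. standard b \<and> b \<sim> a"
proof -
  have "a \<in> {b. b \<sim> a}" by (simp add: zero_mem)
  then obtain b where b: "b \<in> {b. b \<sim> a}" "\<And>c. c \<in> {b. b \<sim> a} \<Longrightarrow> (b, c) \<in> r"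
    using r_min by metis
  then show ?thesis unfolding standard_def by (blast intro: cong_trans)
qed

lemma standard_le:
  assumes "a \<le> b" "standard b"
  shows "standard a"
proof -
  obtain c where c: "b = a + c" using le_imp_eq_add[OF assms(1)] .
  have "(a, d) \<in> r" if "d \<sim> a" for d
  proof -
    have "d + c \<sim> b" using that unfolding c cong_add .
    then have "(a + c, d + c) \<in> r" using standardD[OF assms(2)] unfolding c by blast
    then show ?thesis by (rule r_cancel)
  qed
  then show ?thesis by (simp add: standard_def)
qed

lemma corner_below: "\<not> standard a \<Longrightarrow> \<exists>b \<le> a. corner b"
  unfolding corner_def using minimal_below[of "\<lambda>a. \<not> standard a" a] by blast

lemma corner_eq: "\<lbrakk>corner a; corner b; a \<le> b\<rbrakk> \<Longrightarrow> a = b"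
  unfolding corner_def by blast

lemma reducedD:
  assumes "u \<in> reduced_vectors"
  shows "u \<in> L" "corner (pos_part u)" "standard (neg_part u)" "\<not> standard (pos_part u)"
    "u \<noteq> 0" "(neg_part u, pos_part u) \<in> r"
proof -
  show *: "u \<in> L" "corner (pos_part u)" "standard (neg_part u)" "\<not> standard (pos_part u)"
    using assms by (auto simp: reduced_vectors_def corner_def)
  show "u \<noteq> 0" using * by (auto simp: neg_part_eq)
  show "(neg_part u, pos_part u) \<in> r" using * standardD cong_parts by blast
qed

text \<open>A corner and the standard exponent of its class have disjoint supports: otherwise cancelling a common
  variable would produce a smaller nonstandard exponent.\<close>

lemma reduced_vector_of_corner:
  assumes a: "corner a"
  shows "\<exists>u \<in> reduced_vectors. pos_part u = a"
proof -
  have na: "\<not> standard a" using a by (simp add: corner_def)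
  obtain b where b: "standard b" "b \<sim> a" using standard_in_class by blast
  have ba: "b \<noteq> a" "(b, a) \<in> r" using na b standardD cong_sym by blast+
  have disjoint: "a $ i = 0 \<or> b $ i = 0" for i
  proof (rule ccontr)
    assume "\<not> ?thesis"
    then have pos: "0 < a $ i" "0 < b $ i" by auto
    define e :: "nat ^ 'n" where "e = axis i 1"
    define a' where "a' = (\<chi> j. a $ j - e $ j)"
    define b' where "b' = (\<chi> j. b $ j - e $ j)"
    have eq: "a = a' + e" "b = b' + e"
      using pos by (auto simp: vec_eq_iff a'_def b'_def e_def axis_def)
    have "(b', a') \<in> r" using ba(2) unfolding eq by (rule r_cancel)
    moreover have "b' \<sim> a'" using b(2) unfolding eq cong_add .
    moreover have "b' \<noteq> a'" using ba(1) eq by auto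
    ultimately have "\<not> standard a'" using nonstandardI by blast
    moreover have "a' \<le> a" unfolding eq(1) by (rule le_add_vec)
    ultimately have "a' = a" using a by (auto simp: corner_def)
    then have "a' $ i = a $ i" by simp
    then show False using pos by (simp add: a'_def e_def)
  qed
  define u where "u = ivec a - ivec b"
  have "pos_part u $ i = a $ i" "neg_part u $ i = b $ i" for i
    using disjoint[of i] by (auto simp: u_def pos_part_def neg_part_def)
  then have parts: "pos_part u = a" "neg_part u = b" by (simp_all add: vec_eq_iff)
  have "u \<in> L" using b(2) cong_sym by (simp add: u_def)
  then have "u \<in> reduced_vectors" using a b parts by (simp add: reduced_vectors_def)
  then show ?thesis using parts by blast
qed

lemma reduced_vectors_antichain:
  assumes u: "u \<in> reduced_vectors" and v: "v \<in> reduced_vectors" and le: "pos_part u \<le> pos_part v"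
  shows "u = v"
proof -
  have pos: "pos_part u = pos_part v" using corner_eq reducedD(2) u v le by blast
  have "neg_part u \<sim> pos_part u" "pos_part v \<sim> neg_part v"
    using reducedD(1) u v cong_parts cong_sym by blast+
  then have "neg_part u \<sim> neg_part v" using cong_trans pos by metis
  then have "neg_part u = neg_part v" using standard_unique reducedD(3) u v by blast
  then show ?thesis using pos parts_diff by metis
qed

text \<open>The corners form an antichain, and a vector here is determined by its corner.\<close>

lemma finite_reduced_vectors: "finite reduced_vectors"
proof (rule finite_imageD)
  show "finite (pos_part ` reduced_vectors)"
  proof (rule finite_antichain)
    fix a b assume ab: "a \<in> pos_part ` reduced_vectors" "b \<in> pos_part ` reduced_vectors" "a \<le> b"
    obtain u v where "u \<in> reduced_vectors" "a = pos_part u" "v \<in> reduced_vectors" "b = pos_part v"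
      using ab(1,2) by blast
    then show "a = b" using corner_eq[OF reducedD(2) reducedD(2), of u v] ab(3) by simp
  qed
  show "inj_on pos_part reduced_vectors"
  proof (rule inj_onI)
    fix u v assume "u \<in> reduced_vectors" "v \<in> reduced_vectors" "pos_part u = pos_part v"
    then show "u = v" using reduced_vectors_antichain[of u v] by simp
  qed
qed

text \<open>Let \<open>v\<close> be conformal to \<open>u\<close> and below it. Its negative part divides a standard exponent and is
  standard, so its positive part is not; by minimality it is the corner itself, and the negative
  parts agree as standard exponents of one class.\<close>

lemma reduced_vectors_graver: "reduced_vectors \<subseteq> graver"
proof
  fix u assume u: "u \<in> reduced_vectors"
  have "v = u" if v: "v \<in> L" "v \<noteq> 0" "pos_part v \<le> pos_part u" "neg_part v \<le> neg_part u" for v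
  proof -
    have n: "standard (neg_part v)" using standard_le v(4) reducedD(3)[OF u] by blast
    have c: "pos_part v \<sim> neg_part v" using v(1) cong_parts by blast
    have "\<not> standard (pos_part v)" using standard_unique[OF _ n c] parts_neq[OF v(2)] by blast
    then have p: "pos_part v = pos_part u" using reducedD(2)[OF u] v(3) by (simp add: corner_def)
    have "pos_part u \<sim> neg_part u" using reducedD(1)[OF u] cong_parts by blast
    then have "neg_part v \<sim> neg_part u" using c p cong_sym cong_trans by metis
    then have "neg_part v = neg_part u" using standard_unique n reducedD(3)[OF u] by blast
    then show ?thesis using p parts_diff by metis
  qed
  then show "u \<in> graver" using reducedD(1,5)[OF u] by (simp add: graver_def)
qed

text \<open>The first of the two properties through which a Groebner basis enters the argument in rank two.\<close>

lemma reducer: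
  assumes v: "v \<in> L" "v \<noteq> 0" "(neg_part v, pos_part v) \<in> r"
  shows "\<exists>u \<in> reduced_vectors. pos_part u \<le> pos_part v"
proof -
  have "neg_part v \<sim> pos_part v" using v(1) cong_parts cong_sym by blast
  then have "\<not> standard (pos_part v)" using nonstandardI v(3) parts_neq[OF v(2)] by metis
  then obtain a where "a \<le> pos_part v" "corner a" using corner_below by blast
  then show ?thesis using reduced_vector_of_corner by blast
qed

lemma lead_exp_nonstandard:
  assumes "f \<in> (lattice_ideal :: ('n, 'k::field) mpoly set)" "f \<noteq> 0"
  shows "\<not> standard (lead_exp r f)"
  using congruent_key[OF assms(1) lead_exp_in_keys[OF assms(2)]] lead_exp_greatest[OF assms(2)]
    nonstandardI by blast

lemma lead_exp_mon_diff:
  assumes "(b, a) \<in> r" "b \<noteq> a"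
  shows "lead_exp r (mon a - mon b :: ('n, 'k::field) mpoly) = a"
  using assms r_refl by (intro lead_exp_eq) (auto simp: keys_mon_diff)

lemma lead_exp_binom:
  assumes "u \<in> reduced_vectors"
  shows "lead_exp r (binom u :: ('n, 'k::field) mpoly) = pos_part u"
  unfolding binom_def
  using reducedD(6)[OF assms] parts_neq[OF reducedD(5)[OF assms]] by (intro lead_exp_mon_diff) auto

lemma initial_ideal_lattice_ideal:
  "mon a \<in> initial_ideal r (lattice_ideal :: ('n, 'k::field) mpoly set) \<longleftrightarrow> \<not> standard a"
proof
  assume "mon a \<in> initial_ideal r (lattice_ideal :: ('n, 'k) mpoly set)"
  then show "\<not> standard a"
    unfolding mon_in_initial_ideal using lead_exp_nonstandard standard_le by blast
next
  assume a: "\<not> standard a"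
  obtain b where b: "standard b" "b \<sim> a" using standard_in_class by blast
  let ?f = "mon a - mon b :: ('n, 'k) mpoly"
  have ba: "b \<noteq> a" "(b, a) \<in> r" using a b standardD cong_sym by blast+
  then have "lead_exp r ?f = a" by (intro lead_exp_mon_diff)
  moreover have "?f \<in> lattice_ideal" using mon_diff_in_lattice_ideal cong_sym b(2) by blast
  moreover have "?f \<noteq> 0" using keys_mon_diff[of a b] ba(1) by (metis insert_not_empty keys_zero)
  ultimately show "mon a \<in> initial_ideal r (lattice_ideal :: ('n, 'k) mpoly set)"
    unfolding mon_in_initial_ideal by (intro bexI[of _ ?f] conjI) simp_all
qed

lemma groebner_basis_iff:
  assumes "G \<subseteq> (lattice_ideal :: ('n, 'k::field) mpoly set)"
  shows "initial_ideal r G = initial_ideal r lattice_ideal \<longleftrightarrow>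
    (\<forall>a. \<not> standard a \<longrightarrow> (\<exists>g \<in> G. g \<noteq> 0 \<and> lead_exp r g \<le> a))"
proof
  assume "initial_ideal r G = initial_ideal r lattice_ideal"
  then show "\<forall>a. \<not> standard a \<longrightarrow> (\<exists>g \<in> G. g \<noteq> 0 \<and> lead_exp r g \<le> a)"
    using initial_ideal_lattice_ideal mon_in_initial_ideal by metis
next
  assume *: "\<forall>a. \<not> standard a \<longrightarrow> (\<exists>g \<in> G. g \<noteq> 0 \<and> lead_exp r g \<le> a)"
  have "initial_ideal r lattice_ideal \<subseteq> initial_ideal r G"
    unfolding initial_ideal_def[of r lattice_ideal]
  proof (rule ideal.span_minimal)
    show "{mon (lead_exp r f) | f. f \<in> (lattice_ideal :: ('n, 'k) mpoly set) \<and> f \<noteq> 0} \<subseteq> initial_ideal r G"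
    proof
      fix x :: "('n, 'k) mpoly" assume "x \<in> {mon (lead_exp r f) | f. f \<in> (lattice_ideal :: ('n, 'k) mpoly set) \<and> f \<noteq> 0}"
      then obtain f :: "('n, 'k) mpoly" where x: "x = mon (lead_exp r f)"
        and f: "f \<in> lattice_ideal" "f \<noteq> 0" by blast
      show "x \<in> initial_ideal r G"
        unfolding x mon_in_initial_ideal using * lead_exp_nonstandard[OF f] by blast
    qed
    show "ideal.subspace (initial_ideal r G)"
      unfolding initial_ideal_def by (rule ideal.subspace_span)
  qed
  moreover have "initial_ideal r G \<subseteq> initial_ideal r lattice_ideal"
    unfolding initial_ideal_def using assms by (intro ideal.span_mono) blast
  ultimately show "initial_ideal r G = initial_ideal r lattice_ideal" by blast
qed

lemma reduced_groebner_basis_reduced_vectors: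
  "reduced_groebner_basis r lattice_ideal (binom ` reduced_vectors :: ('n, 'k::field) mpoly set)"
proof -
  let ?G = "binom ` reduced_vectors :: ('n, 'k) mpoly set"
  have sub: "?G \<subseteq> lattice_ideal" using reducedD(1) binom_in_lattice_ideal by blast
  have "\<exists>g \<in> ?G. g \<noteq> 0 \<and> lead_exp r g \<le> a" if a: "\<not> standard a" for a
  proof -
    obtain b where "b \<le> a" "corner b" using corner_below[OF a] by blast
    then obtain u where "u \<in> reduced_vectors" "pos_part u \<le> a" using reduced_vector_of_corner by blast
    then show ?thesis using lead_exp_binom reducedD(5) binom_nonzero by (metis imageI)
  qed
  then have "groebner_basis r lattice_ideal ?G"
    unfolding groebner_basis_def using sub groebner_basis_iff[OF sub] finite_reduced_vectors by blast
  moreover have "Poly_Mapping.lookup g (lead_exp r g) = 1 \<and>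
      (\<forall>a \<in> Poly_Mapping.keys g. mon a \<notin> initial_ideal r (?G - {g}))" if g: "g \<in> ?G" for g
  proof -
    obtain u where u: "u \<in> reduced_vectors" "g = binom u" using g by blast
    have "Poly_Mapping.lookup g (pos_part u) = 1"
      using parts_neq[OF reducedD(5)[OF u(1)]]
      by (simp add: u(2) binom_def mon_def lookup_minus lookup_single when_def)
    moreover have "mon a \<notin> initial_ideal r (?G - {g})" if a: "a \<in> Poly_Mapping.keys g" for a
    proof
      assume "mon a \<in> initial_ideal r (?G - {g})"
      then obtain h where h: "h \<in> ?G" "h \<noteq> g" "lead_exp r h \<le> a"
        unfolding mon_in_initial_ideal by blast
      then obtain v where hv: "v \<in> reduced_vectors" "h = binom v" by blast
      then have v: "v \<in> reduced_vectors" "binom v \<noteq> g" "pos_part v \<le> a"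
        using h lead_exp_binom[OF hv(1)] by metis+
      have "a = pos_part u \<or> a = neg_part u" using a keys_binom[OF reducedD(5)[OF u(1)]] u(2) by auto
      then show False
      proof
        assume "a = pos_part u"
        then show False using reduced_vectors_antichain[OF v(1) u(1)] v u(2) by blast
      next
        assume "a = neg_part u"
        then show False using standard_le[OF v(3)] reducedD(3)[OF u(1)] reducedD(4)[OF v(1)] by blast
      qed
    qed
    ultimately show ?thesis using lead_exp_binom[OF u(1)] u(2) by metis
  qed
  ultimately show ?thesis unfolding reduced_groebner_basis_def by blast
qed

text \<open>The nonleading exponents of an element of a reduced basis are standard, so distinct ones are incongruent.
  As every class contributes coefficient sum zero, only the class of the leading exponent
  can occur, with one standard exponent besides the leading one.\<close>

lemma reduced_groebner_basis_element:
  assumes G: "reduced_groebner_basis r (lattice_ideal :: ('n, 'k::field) mpoly set) G" and g: "g \<in> G"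
  shows "\<exists>u \<in> reduced_vectors. g = binom u"
proof -
  have GI: "G \<subseteq> lattice_ideal" and "initial_ideal r G = initial_ideal r lattice_ideal"
    using G unfolding reduced_groebner_basis_def groebner_basis_def by blast+
  then have init: "\<exists>g \<in> G. g \<noteq> 0 \<and> lead_exp r g \<le> a" if "\<not> standard a" for a
    using groebner_basis_iff[OF GI] that by blast
  have lc: "Poly_Mapping.lookup g (lead_exp r g) = 1"
    and red: "\<And>a h. \<lbrakk>a \<in> Poly_Mapping.keys g; h \<in> G; h \<noteq> 0; lead_exp r h \<le> a\<rbrakk> \<Longrightarrow> h = g"
    using G g unfolding reduced_groebner_basis_def mon_in_initial_ideal by blast+
  have gI: "g \<in> lattice_ideal" using GI g by blast
  have g0: "g \<noteq> 0" using lc by auto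
  define a where "a = lead_exp r g"
  have a: "a \<in> Poly_Mapping.keys g" "\<not> standard a"
    using lead_exp_in_keys[OF g0] lead_exp_nonstandard[OF gI g0] by (simp_all add: a_def)
  have std: "standard c" if c: "c \<in> Poly_Mapping.keys g" "c \<noteq> a" for c
  proof (rule ccontr)
    assume "\<not> standard c"
    then obtain h where h: "h \<in> G" "h \<noteq> 0" "lead_exp r h \<le> c" using init by blast
    then have "a \<le> c" using red[OF c(1)] a_def by blast
    then have "(a, c) \<in> r" by (rule r_le)
    moreover have "(c, a) \<in> r" using lead_exp_greatest[OF g0 c(1)] by (simp add: a_def)
    ultimately show False using c(2) r_antisym by blast
  qed
  obtain b where b: "b \<in> Poly_Mapping.keys g" "b \<noteq> a" "b \<sim> a"
    using congruent_key[OF gI a(1)] by blast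
  have cls: "c = a \<or> c = b" if c: "c \<in> Poly_Mapping.keys g" for c
  proof (rule ccontr)
    assume *: "\<not> ?thesis"
    obtain d where d: "d \<in> Poly_Mapping.keys g" "d \<noteq> c" "d \<sim> c" using congruent_key[OF gI c] by blast
    show False
    proof (cases "d = a")
      case True
      then have "b \<sim> c" using b(3) d(3) cong_trans by blast
      then show False using standard_unique std b c * by metis
    next
      case False
      then show False using standard_unique std d c * by metis
    qed
  qed
  then have keys: "Poly_Mapping.keys g = {a, b}" using a b by blast
  have "fiber_sum g (ivec a) = Poly_Mapping.lookup g a + Poly_Mapping.lookup g b"
    unfolding fiber_sum_def keys using b(2,3) cong_refl[of a] by auto
  then have "Poly_Mapping.lookup g b = - 1"
    using fiber_sum_lattice_ideal[OF gI] lc by (simp add: a_def add_eq_0_iff)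
  then have g_eq: "g = mon a - mon b"
    using keys b(2) lc by (intro mon_diff_eq) (auto simp: a_def)
  have "corner a"
  proof -
    have "c = a" if c: "c \<le> a" "\<not> standard c" for c
    proof -
      obtain h where h: "h \<in> G" "h \<noteq> 0" "lead_exp r h \<le> c" using init c(2) by blast
      then have "h = g" using red[OF a(1)] c(1) order_trans by blast
      then have "a \<le> c" using h by (simp add: a_def)
      then show ?thesis using c(1) by simp
    qed
    then show ?thesis using a(2) by (auto simp: corner_def)
  qed
  then obtain u where u: "u \<in> reduced_vectors" "pos_part u = a" using reduced_vector_of_corner by blast
  have "a \<sim> neg_part u" using reducedD(1)[OF u(1)] u(2) cong_parts by metis
  then have "b \<sim> neg_part u" using b(3) cong_trans by blast
  then have "neg_part u = b" using standard_unique std b(1,2) reducedD(3)[OF u(1)] by metis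
  then have "g = binom u" using g_eq u(2) by (simp add: binom_def)
  then show ?thesis using u by blast
qed

lemma reduced_groebner_basis_unique:
  assumes G: "reduced_groebner_basis r (lattice_ideal :: ('n, 'k::field) mpoly set) G"
  shows "G = binom ` reduced_vectors"
proof
  show sub: "G \<subseteq> binom ` reduced_vectors" using reduced_groebner_basis_element[OF G] by blast
  show "binom ` reduced_vectors \<subseteq> G"
  proof clarify
    fix u assume u: "u \<in> reduced_vectors"
    have "G \<subseteq> lattice_ideal" "initial_ideal r G = initial_ideal r lattice_ideal"
      using G unfolding reduced_groebner_basis_def groebner_basis_def by blast+
    then obtain g where g: "g \<in> G" "lead_exp r g \<le> pos_part u"
      using groebner_basis_iff reducedD(4)[OF u] by blast
    then obtain v where v: "v \<in> reduced_vectors" "g = binom v" using sub by blast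
    have "pos_part v \<le> pos_part u" using g(2) unfolding v(2) lead_exp_binom[OF v(1)] .
    then have "v = u" by (rule reduced_vectors_antichain[OF v(1) u])
    then show "binom u \<in> G" using g v by simp
  qed
qed

text \<open>Reduction by the basis, which terminates because the order is well-founded.\<close>

lemma normal_form:
  "\<exists>s. standard s \<and> c \<sim> s \<and>
    (mon c - mon s :: ('n, 'k::field) mpoly) \<in> ideal.span (binom ` reduced_vectors)"
proof (induction c rule: wf_induct_rule[OF wf_r])
  case (1 c)
  show ?case
  proof (cases "standard c")
    case True
    then show ?thesis using cong_refl ideal.span_zero by (intro exI[of _ c]) auto
  next
    case False
    then obtain a where "a \<le> c" "corner a" using corner_below by blast
    then obtain u where u: "u \<in> reduced_vectors" "pos_part u \<le> c" using reduced_vector_of_corner by blast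
    then obtain d where d: "c = pos_part u + d" using le_imp_eq_add by blast
    let ?c = "neg_part u + d"
    have "(?c, c) \<in> r" using r_add[OF reducedD(6)[OF u(1)]] d by simp
    moreover have "?c \<noteq> c" using parts_neq[OF reducedD(5)[OF u(1)]] d by auto
    ultimately have "(?c, c) \<in> r - Id" by simp
    then obtain s where s: "standard s" "?c \<sim> s"
      "(mon ?c - mon s :: ('n, 'k) mpoly) \<in> ideal.span (binom ` reduced_vectors)"
      using 1 by blast
    have "(mon c - mon s :: ('n, 'k) mpoly) = mon d * binom u + (mon ?c - mon s)"
      by (simp add: d binom_def right_diff_distrib mon_mult add.commute)
    also have "\<dots> \<in> ideal.span (binom ` reduced_vectors)"
      using u(1) by (intro ideal.span_add[OF ideal.span_scale[OF ideal.span_base] s(3)]) blast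
    finally have "(mon c - mon s :: ('n, 'k) mpoly) \<in> ideal.span (binom ` reduced_vectors)" .
    moreover have "c \<sim> ?c" unfolding d cong_add cong_parts using reducedD(1)[OF u(1)] .
    then have "c \<sim> s" using s(2) cong_trans by blast
    ultimately show ?thesis using s(1) by blast
  qed
qed

lemma reduced_vectors_generate:
  "ideal.span (binom ` reduced_vectors) = (lattice_ideal :: ('n, 'k::field) mpoly set)"
proof
  show "ideal.span (binom ` reduced_vectors) \<subseteq> (lattice_ideal :: ('n, 'k) mpoly set)"
    unfolding lattice_ideal_def using reducedD(1) by (intro ideal.span_mono) blast
  have "binom u \<in> (ideal.span (binom ` reduced_vectors) :: ('n, 'k) mpoly set)" if "u \<in> L" for u
  proof -
    obtain s where s: "standard s" "pos_part u \<sim> s"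
      "(mon (pos_part u) - mon s :: ('n, 'k) mpoly) \<in> ideal.span (binom ` reduced_vectors)"
      using normal_form by blast
    obtain t where t: "standard t" "neg_part u \<sim> t"
      "(mon (neg_part u) - mon t :: ('n, 'k) mpoly) \<in> ideal.span (binom ` reduced_vectors)"
      using normal_form by blast
    have "s \<sim> t" using s(2) t(2) \<open>u \<in> L\<close> cong_parts cong_sym cong_trans by meson
    then have "s = t" using standard_unique s(1) t(1) by blast
    then have "(binom u :: ('n, 'k) mpoly) = (mon (pos_part u) - mon s) - (mon (neg_part u) - mon t)"
      by (simp add: binom_def)
    then show ?thesis using ideal.span_diff[OF s(3) t(3)] by simp
  qed
  then show "(lattice_ideal :: ('n, 'k) mpoly set) \<subseteq> ideal.span (binom ` reduced_vectors)"
    unfolding lattice_ideal_def by (intro ideal.span_minimal ideal.subspace_span) blast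
qed

end

section \<open>Robustness in terms of vectors\<close>

lemma up_to_sign_binom: "up_to_sign (binom ` U) = (\<lambda>u. {binom u, - binom u}) ` U"
  by (simp add: up_to_sign_def image_image)

text \<open>Supports are compared instead of coefficients, since in characteristic two a binomial equals its opposite.\<close>

lemma binom_class_eq_iff:
  assumes "u \<noteq> 0"
  shows "{binom u, - binom u} = {binom v, - binom v :: ('n::finite, 'k::field) mpoly} \<longleftrightarrow> u = v \<or> u = - v"
proof
  assume eq: "{binom u, - binom u} = {binom v, - binom v :: ('n, 'k) mpoly}"
  then have "(binom u :: ('n, 'k) mpoly) = binom v \<or> (binom u :: ('n, 'k) mpoly) = - binom v" by blast
  then have "Poly_Mapping.keys (binom u :: ('n, 'k) mpoly) = Poly_Mapping.keys (binom v :: ('n, 'k) mpoly)"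
    by (auto simp: in_keys_iff)
  moreover from this have "v \<noteq> 0" using keys_binom[OF assms] by (auto simp: binom_def neg_part_eq)
  ultimately have "{pos_part u, neg_part u} = {pos_part v, neg_part v}"
    using keys_binom[OF assms] keys_binom by metis
  then consider "pos_part u = pos_part v" "neg_part u = neg_part v"
    | "pos_part u = neg_part v" "neg_part u = pos_part v" by (auto simp: doubleton_eq_iff)
  then show "u = v \<or> u = - v"
  proof cases
    case 1
    then show ?thesis using parts_diff by metis
  next
    case 2
    then show ?thesis using parts_diff[of u] parts_diff[of v] by (metis minus_diff_eq)
  qed
qed (auto simp: binom_uminus)

lemma span_up_to_sign:
  "ideal.span (\<Union> (up_to_sign S)) = (ideal.span S :: ('n::finite, 'k::field) mpoly set)"
proof
  show "ideal.span S \<subseteq> ideal.span (\<Union> (up_to_sign S))"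
    by (rule ideal.span_mono) (auto simp: up_to_sign_def)
  have "\<Union> (up_to_sign S) \<subseteq> ideal.span S"
    using ideal.span_base[of _ S] ideal.span_neg[of _ S] by (auto simp: up_to_sign_def)
  then show "ideal.span (\<Union> (up_to_sign S)) \<subseteq> ideal.span S"
    by (rule ideal.span_minimal[OF _ ideal.subspace_span])
qed

context toric_lattice
begin

definition universal_vectors :: "(int ^ 'n) set"
  where "universal_vectors = (\<Union>r \<in> Collect monomial_order. ordered_lattice.reduced_vectors L r)"

lemma ordered_lattice: "monomial_order r \<Longrightarrow> ordered_lattice L r"
  by unfold_locales

lemma universal_groebner_basis_eq:
  "universal_groebner_basis (lattice_ideal :: ('n, 'k::field) mpoly set) = binom ` universal_vectors"
proof -
  have "reduced_groebner_basis r (lattice_ideal :: ('n, 'k) mpoly set) G \<longleftrightarrow>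
      G = binom ` ordered_lattice.reduced_vectors L r" if "monomial_order r" for r G
  proof -
    interpret ordered_lattice L r using that by (rule ordered_lattice)
    show ?thesis using reduced_groebner_basis_unique reduced_groebner_basis_reduced_vectors by blast
  qed
  then show ?thesis unfolding universal_groebner_basis_def universal_vectors_def by blast
qed

lemma graver_basis_eq: "graver_basis (lattice_ideal :: ('n, 'k::field) mpoly set) = binom ` graver"
  unfolding graver_basis_def primitive_iff by simp

lemma universal_vectors_graver: "universal_vectors \<subseteq> graver"
  unfolding universal_vectors_def using ordered_lattice ordered_lattice.reduced_vectors_graver by blast

lemma reduced_vectors_universal:
  "monomial_order r \<Longrightarrow> ordered_lattice.reduced_vectors L r \<subseteq> universal_vectors"
  unfolding universal_vectors_def by blast

lemma universal_vectors_generate: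
  "ideal.span (binom ` universal_vectors) = (lattice_ideal :: ('n, 'k::field) mpoly set)"
proof
  obtain r :: "(nat ^ 'n) rel" where r: "monomial_order r" using exists_monomial_order[of "{}"] by auto
  have "(lattice_ideal :: ('n, 'k) mpoly set) = ideal.span (binom ` ordered_lattice.reduced_vectors L r)"
    by (rule ordered_lattice.reduced_vectors_generate[OF ordered_lattice[OF r], symmetric])
  also have "\<dots> \<subseteq> ideal.span (binom ` universal_vectors)"
    using reduced_vectors_universal[OF r] by (intro ideal.span_mono) blast
  finally show "(lattice_ideal :: ('n, 'k) mpoly set) \<subseteq> ideal.span (binom ` universal_vectors)" .
  show "ideal.span (binom ` universal_vectors) \<subseteq> (lattice_ideal :: ('n, 'k) mpoly set)"
    unfolding lattice_ideal_def using universal_vectors_graver graver_in by (intro ideal.span_mono) blast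
qed

text \<open>A generating subset of a minimal generating set is the whole set.\<close>

lemma strongly_robust_imp_robust:
  assumes "strongly_robust (lattice_ideal :: ('n, 'k::field) mpoly set)"
  shows "robust (lattice_ideal :: ('n, 'k) mpoly set)"
proof -
  let ?G = "up_to_sign (binom ` graver :: ('n, 'k) mpoly set)"
  let ?U = "up_to_sign (binom ` universal_vectors :: ('n, 'k) mpoly set)"
  have "?U \<subseteq> ?G" using universal_vectors_graver by (auto simp: up_to_sign_def)
  moreover have "\<not> ?U \<subset> ?G"
    using assms universal_vectors_generate[where 'k = 'k] span_up_to_sign[of "binom ` universal_vectors"]
    unfolding strongly_robust_def minimal_generating_set_def graver_basis_eq by metis
  ultimately have "?U = ?G" by blast
  then show ?thesis
    using assms unfolding strongly_robust_def robust_def graver_basis_eq universal_groebner_basis_eq by simp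
qed

text \<open>A single reduced Groebner basis generates, so by minimality it is, up to sign, the whole universal one.\<close>

lemma robust_reduced_vectors:
  assumes rob: "robust (lattice_ideal :: ('n, 'k::field) mpoly set)" and r: "monomial_order r"
    and u: "u \<in> universal_vectors"
  shows "u \<in> ordered_lattice.reduced_vectors L r \<or> - u \<in> ordered_lattice.reduced_vectors L r"
proof -
  let ?R = "up_to_sign (binom ` ordered_lattice.reduced_vectors L r :: ('n, 'k) mpoly set)"
  let ?U = "up_to_sign (binom ` universal_vectors :: ('n, 'k) mpoly set)"
  have "?R \<subseteq> ?U" using reduced_vectors_universal[OF r] by (auto simp: up_to_sign_def)
  moreover have "\<not> ?R \<subset> ?U"
    using rob ordered_lattice.reduced_vectors_generate[OF ordered_lattice[OF r], where 'k = 'k]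
      span_up_to_sign[of "binom ` ordered_lattice.reduced_vectors L r"]
    unfolding robust_def minimal_generating_set_def universal_groebner_basis_eq by metis
  ultimately have "?R = ?U" by blast
  then have "{binom u, - binom u :: ('n, 'k) mpoly} \<in> ?R" using u by (simp add: up_to_sign_binom)
  then obtain v where v: "v \<in> ordered_lattice.reduced_vectors L r"
    "{binom u, - binom u} = {binom v, - binom v :: ('n, 'k) mpoly}"
    unfolding up_to_sign_binom by blast
  moreover have "u \<noteq> 0" using u universal_vectors_graver graver_nonzero by blast
  ultimately have "u = v \<or> u = - v" using binom_class_eq_iff by blast
  then show ?thesis using v(1) by auto
qed

end

section \<open>Lattices of rank two\<close>

context toric_lattice
begin

text \<open>These are the cones \<open>K\<^sub>+\<close> and \<open>K\<^sub>-\<close> of the introduction. A coordinate at which \<open>h\<close> vanishes enters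
  both of them; this is what makes them describe divisibility exactly (\<open>pos_part_le_iff_cones\<close>).\<close>

definition nonneg_cone :: "int ^ 'n \<Rightarrow> (int ^ 'n) set"
  where "nonneg_cone h = {w \<in> L. \<forall>i. 0 \<le> h $ i \<longrightarrow> 0 \<le> w $ i}"

definition nonpos_cone :: "int ^ 'n \<Rightarrow> (int ^ 'n) set"
  where "nonpos_cone h = {w \<in> L. \<forall>i. h $ i \<le> 0 \<longrightarrow> w $ i \<le> 0}"

lemma pos_part_le_iff_cones:
  assumes "h \<in> L" "g \<in> L"
  shows "pos_part g \<le> pos_part h \<longleftrightarrow> g \<in> nonpos_cone h \<and> h - g \<in> nonneg_cone h"
proof -
  have "x \<le> max 0 y \<longleftrightarrow> (y \<le> 0 \<longrightarrow> x \<le> 0) \<and> (0 \<le> y \<longrightarrow> 0 \<le> y - x)" for x y :: int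
    by linarith
  then show ?thesis
    using assms diff_mem[OF assms] by (auto simp: pos_part_le_iff nonneg_cone_def nonpos_cone_def)
qed

lemma neg_part_le_iff_cones:
  assumes "h \<in> L" "g \<in> L"
  shows "neg_part g \<le> neg_part h \<longleftrightarrow> g \<in> nonneg_cone h \<and> h - g \<in> nonpos_cone h"
proof -
  have "- x \<le> max 0 (- y) \<longleftrightarrow> (0 \<le> y \<longrightarrow> 0 \<le> x) \<and> (y \<le> 0 \<longrightarrow> y - x \<le> 0)" for x y :: int
    by linarith
  then show ?thesis
    using assms diff_mem[OF assms]
    by (auto simp: neg_part_eq pos_part_le_iff nonneg_cone_def nonpos_cone_def)
qed

text \<open>This is primitivity in terms of cones: \<open>h\<close> is not a sum of two nonzero vectors that are
  conformal to it.\<close>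

lemma graver_irreducible:
  assumes h: "h \<in> graver" and p: "p \<in> nonpos_cone h" "p \<in> nonneg_cone h"
    and q: "h - p \<in> nonpos_cone h" "h - p \<in> nonneg_cone h"
  shows "p = 0 \<or> p = h"
proof -
  have L: "h \<in> L" "p \<in> L" using h p graver_in by (auto simp: nonpos_cone_def)
  have "pos_part p \<le> pos_part h" "neg_part p \<le> neg_part h"
    using pos_part_le_iff_cones[OF L] neg_part_le_iff_cones[OF L] p q by simp_all
  then show ?thesis using graverD[OF h] L by blast
qed

text \<open>A negative multiple of \<open>h\<close> is excluded by a negative coordinate of \<open>h\<close>, and a multiple by a
  factor greater than one by a positive coordinate. What remains is conformal to \<open>h\<close>.\<close>

lemma parallel_below_eq:
  assumes h: "h \<in> graver" and g: "g \<in> L" "g \<noteq> 0" and a: "(0::int) < a"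
    and par: "\<And>i. a * g $ i = b * h $ i" and le: "pos_part g \<le> pos_part h"
  shows "g = h"
proof -
  have hL: "h \<in> L" "h \<noteq> 0" using h graver_in graver_nonzero by auto
  obtain i where i: "h $ i < 0" using has_neg hL by blast
  obtain j where j: "0 < h $ j" using has_pos hL by blast
  have "g $ i \<le> 0" using le i unfolding pos_part_le_iff by (metis less_le max.absorb1)
  then have "b * h $ i \<le> 0" using par[of i] a by (metis mult_nonneg_nonpos order_less_imp_le)
  then have b: "0 \<le> b" using i by (auto simp: mult_le_0_iff)
  have "g $ j \<le> h $ j" using le j unfolding pos_part_le_iff by (metis less_le max.absorb2)
  then have "a * g $ j \<le> a * h $ j" using a by simp
  then have "b * h $ j \<le> a * h $ j" using par by simp
  then have ba: "b \<le> a" using j by simp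
  have "neg_part g \<le> neg_part h"
    unfolding neg_part_eq pos_part_le_iff
  proof
    fix k
    show "(- g) $ k \<le> max 0 ((- h) $ k)"
    proof (cases "h $ k \<le> 0")
      case True
      then have "a * h $ k \<le> b * h $ k" using ba by (simp add: mult_right_mono_neg)
      then have "a * h $ k \<le> a * g $ k" using par by simp
      then show ?thesis using a by simp
    next
      case False
      then have "0 \<le> a * g $ k" using par b by simp
      then have "0 \<le> g $ k" using a by (simp add: zero_le_mult_iff)
      then show ?thesis by simp
    qed
  qed
  then show ?thesis using graverD[OF h] g le by blast
qed

lemma graver_parallel_eq:
  assumes e: "e \<in> graver" and f: "f \<in> graver" and ab: "(0::int) < a" "0 < b"
    and par: "\<And>i. a * e $ i = b * f $ i"
  shows "e = f"
proof -
  have *: "e = f" if e: "e \<in> graver" and f: "f \<in> graver" and ab: "(0::int) < a" "0 < b"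
    and par: "\<And>i. a * e $ i = b * f $ i" and "b \<le> a" for e f a b
  proof (rule parallel_below_eq[OF f _ _ ab(1) par])
    show "pos_part e \<le> pos_part f" unfolding pos_part_le_iff
    proof
      fix i
      show "e $ i \<le> max 0 (f $ i)"
      proof (cases "0 \<le> f $ i")
        case True
        then have "a * e $ i \<le> a * f $ i" using par \<open>b \<le> a\<close> by (simp add: mult_right_mono)
        then show ?thesis using ab by simp
      next
        case False
        then have "a * e $ i \<le> 0" using par ab by (simp add: mult_le_0_iff)
        then show ?thesis using ab by (simp add: mult_le_0_iff)
      qed
    qed
  qed (use e graver_in graver_nonzero in auto)
  show ?thesis
  proof (cases "b \<le> a")
    case True then show ?thesis using * assms by blast
  next
    case False
    then show ?thesis using *[OF f e ab(2,1)] par by auto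
  qed
qed

end

text \<open>In a lattice of rank two this is, for suitable coordinates, an orientation form of the plane spanned by
  the lattice: \<open>0 < minor p q u v\<close> says that \<open>v\<close> lies to the left of \<open>u\<close>.\<close>

definition minor :: "'n \<Rightarrow> 'n \<Rightarrow> int ^ 'n \<Rightarrow> int ^ 'n \<Rightarrow> int"
  where "minor p q u v = u $ p * v $ q - u $ q * v $ p"

lemma minor_simps [simp]:
  "minor p q (u + v) w = minor p q u w + minor p q v w"
  "minor p q u (v + w) = minor p q u v + minor p q u w"
  "minor p q (u - v) w = minor p q u w - minor p q v w"
  "minor p q u (v - w) = minor p q u v - minor p q u w"
  "minor p q (- u) w = - minor p q u w"
  "minor p q u (- w) = - minor p q u w"
  "minor p q u u = 0" "minor p q 0 u = 0" "minor p q u 0 = 0"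
  unfolding minor_def by (simp_all add: left_diff_distrib right_diff_distrib distrib_left distrib_right)

lemma minor_commute: "minor p q u v = - minor p q v u"
  unfolding minor_def by simp

lemma minor_swap: "minor q p u v = - minor p q u v"
  unfolding minor_def by simp

lemma minor_plucker:
  "minor p q h e * minor p q x y = minor p q h x * minor p q e y + minor p q h y * minor p q x e"
  unfolding minor_def by algebra

lemma minor_parallel:
  assumes "\<And>i. a * g $ i = b * h $ i"
  shows "a * minor p q g w = b * minor p q h w"
  using assms[of p] assms[of q] unfolding minor_def by algebra

text \<open>Within the half-plane to the left of \<open>h\<close> the relation of lying to the left is transitive.\<close>

lemma angular_minimum:
  assumes "finite X" "X \<noteq> {}" "\<And>x. x \<in> X \<Longrightarrow> 0 < minor p q h x"
  shows "\<exists>e \<in> X. \<forall>x \<in> X. 0 \<le> minor p q e x"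
  using assms
proof (induction X rule: finite_ne_induct)
  case (singleton x)
  then show ?case by simp
next
  case (insert x F)
  then obtain e where e: "e \<in> F" "\<forall>y \<in> F. 0 \<le> minor p q e y" by auto
  show ?case
  proof (cases "0 \<le> minor p q e x")
    case True
    then show ?thesis using e by auto
  next
    case False
    then have xe: "0 < minor p q x e" using minor_commute[of p q x e] by simp
    have "0 \<le> minor p q x y" if "y \<in> F" for y
    proof -
      have "0 < minor p q h e" "0 < minor p q h x" "0 < minor p q h y" using insert e that by auto
      moreover have "0 \<le> minor p q e y" using e that by auto
      ultimately have "0 \<le> minor p q h e * minor p q x y"
        unfolding minor_plucker[of p q h e x y] using xe by simp
      then show ?thesis using \<open>0 < minor p q h e\<close> by (simp add: zero_le_mult_iff)
    qed
    then show ?thesis by auto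
  qed
qed

text \<open>Rank at most two, in the form in which it is used: the three-by-three minors vanish. Equivalently, Cramer's
  rule writes any three vectors in a linear relation whose coefficients are two-by-two minors.\<close>

locale rank_two_lattice = toric_lattice L for L :: "(int ^ 'n::finite) set" +
  assumes minors: "\<lbrakk>u \<in> L; v \<in> L; w \<in> L\<rbrakk> \<Longrightarrow>
    minor p q v w * u $ i + minor p q w u * v $ i + minor p q u v * w $ i = 0"
begin

lemma cone_scale:
  assumes "p \<in> nonpos_cone h" "q \<in> nonpos_cone h" "w \<in> L" "0 < d" "0 \<le> a" "0 \<le> b"
    and "\<And>i. d * w $ i = a * p $ i + b * q $ i"
  shows "w \<in> nonpos_cone h"
proof -
  have "w $ i \<le> 0" if "h $ i \<le> 0" for i
  proof -
    have "p $ i \<le> 0" "q $ i \<le> 0" using assms that by (auto simp: nonpos_cone_def)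
    then have "d * w $ i \<le> 0"
      using assms by (simp add: add_nonpos_nonpos mult_nonneg_nonpos)
    then show ?thesis using \<open>0 < d\<close> by (simp add: mult_le_0_iff)
  qed
  then show ?thesis using assms by (simp add: nonpos_cone_def)
qed

text \<open>To the left of \<open>h\<close> each sign condition, of either cone, is a bound on the slope in the same direction, or
  constant if it comes from a vanishing coordinate of \<open>h\<close>;
  the cone with the sharper bound is the smaller one. If neither contained the other, a coordinate \<open>i\<close>
  violated on one side and a coordinate \<open>j\<close> violated on the other would give the minor of
  \<open>w\<close> and \<open>w'\<close> both signs.\<close>

lemma cones_nested:
  assumes h: "h \<in> L"
  shows "(\<forall>w \<in> nonpos_cone h. 0 < minor p q h w \<longrightarrow> w \<in> nonneg_cone h) \<or>
    (\<forall>w \<in> nonneg_cone h. 0 < minor p q h w \<longrightarrow> w \<in> nonpos_cone h)"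
proof (rule ccontr)
  assume "\<not> ?thesis"
  then obtain w w' where w: "w \<in> nonpos_cone h" "0 < minor p q h w" "w \<notin> nonneg_cone h"
    and w': "w' \<in> nonneg_cone h" "0 < minor p q h w'" "w' \<notin> nonpos_cone h" by blast
  have L: "w \<in> L" "w' \<in> L" using w w' by (auto simp: nonpos_cone_def nonneg_cone_def)
  obtain i where i: "0 \<le> h $ i" "w $ i < 0" using w L by (auto simp: nonneg_cone_def not_le)
  obtain j where j: "h $ j \<le> 0" "0 < w' $ j" using w' L by (auto simp: nonpos_cone_def not_le)
  have wi: "0 \<le> w' $ i" using w' i by (auto simp: nonneg_cone_def)
  have wj: "w $ j \<le> 0" using w j by (auto simp: nonpos_cone_def)
  have id: "minor p q w w' * h $ k = minor p q h w' * w $ k - minor p q h w * w' $ k" for k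
    using minors[OF h L, of p q k] minor_commute[of p q w' h] by (simp add: algebra_simps)
  have "minor p q h w' * w $ i < 0" "0 \<le> minor p q h w * w' $ i"
    using w w' i wi by (simp_all add: mult_pos_neg)
  then have "minor p q w w' * h $ i < 0" using id[of i] by linarith
  then have 1: "minor p q w w' < 0" using i by (auto simp: mult_less_0_iff)
  have "minor p q h w' * w $ j \<le> 0" "0 < minor p q h w * w' $ j"
    using w w' j wj by (simp_all add: mult_nonneg_nonpos)
  then have "minor p q w w' * h $ j < 0" using id[of j] by linarith
  then show False using 1 j by (auto simp: mult_less_0_iff)
qed

text \<open>The conclusion says that \<open>h\<close> does not lie strictly beyond the segment from \<open>p\<close> to \<open>q\<close>, as seen
  from the origin; hence \<open>h\<close> is on the boundary of the convex hull of the nonzero lattice points of its cone.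
  Suppose it were beyond. Irreducibility keeps \<open>h\<close> inside the parallelogram spanned by \<open>p\<close> and \<open>q\<close>,
  so the reflected point \<open>p + q - h\<close> lies in the triangle with vertices \<open>0\<close>, \<open>p\<close> and \<open>q\<close>. It can replace the one of
  \<open>p\<close> and \<open>q\<close> on its own side of \<open>h\<close>, and the area \<open>minor r s p q\<close> decreases.\<close>

lemma no_lattice_triangle:
  assumes h: "h \<in> graver" and nested: "nonpos_cone h \<subseteq> nonneg_cone h"
    and p: "p \<in> nonpos_cone h" "0 < minor r s p h"
    and q: "q \<in> nonpos_cone h" "0 < minor r s h q"
  shows "minor r s h q + minor r s p h \<le> minor r s p q"
  using p q
proof (induction "nat (minor r s p q)" arbitrary: p q rule: less_induct)
  case less
  note p = less.prems(1,2) and q = less.prems(3,4)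
  define a where "a = minor r s h q"
  define b where "b = minor r s p h"
  define d where "d = minor r s p q"
  have ab: "0 < a" "0 < b" using p q by (auto simp: a_def b_def)
  have L: "h \<in> L" "p \<in> L" "q \<in> L" using h p q graver_in by (auto simp: nonpos_cone_def)
  have hK: "h \<in> nonpos_cone h" using L by (auto simp: nonpos_cone_def)
  have nz: "p \<noteq> 0" "q \<noteq> 0" using p q by auto
  have id: "d * h $ i = a * p $ i + b * q $ i" for i
    using minors[OF L, of r s i] minor_commute[of r s q h] minor_commute[of r s h p]
    by (simp add: a_def b_def d_def algebra_simps)
  have irr: "x = 0 \<or> x = h" if "x \<in> nonpos_cone h" "h - x \<in> nonpos_cone h" for x
    using graver_irreducible[OF h] that nested by blast
  have d0: "0 < d"
  proof -
    obtain i where i: "h $ i < 0" using has_neg L h graver_nonzero by blast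
    have pi: "p $ i \<le> 0" "q $ i \<le> 0" using p q i by (auto simp: nonpos_cone_def)
    have "d * h $ i \<le> 0"
      unfolding id using ab pi by (simp add: add_nonpos_nonpos mult_nonneg_nonpos)
    then have "0 \<le> d" using i by (auto simp: mult_le_0_iff)
    moreover have "d \<noteq> 0"
    proof
      assume "d = 0"
      have "p $ j = 0" for j
      proof (cases "h $ j \<le> 0")
        case True
        then have "p $ j \<le> 0" "q $ j \<le> 0" using p q by (auto simp: nonpos_cone_def)
        then have "a * p $ j \<le> 0" "b * q $ j \<le> 0" using ab by (simp_all add: mult_nonneg_nonpos)
        then have "a * p $ j = 0" using id[of j] unfolding \<open>d = 0\<close> by linarith
        then show ?thesis using ab by simp
      next
        case False
        then have "0 \<le> p $ j" "0 \<le> q $ j" using p q nested by (auto simp: nonneg_cone_def)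
        then have "0 \<le> a * p $ j" "0 \<le> b * q $ j" using ab by simp_all
        then have "a * p $ j = 0" using id[of j] unfolding \<open>d = 0\<close> by linarith
        then show ?thesis using ab by simp
      qed
      then show False using nz by (simp add: vec_eq_iff)
    qed
    ultimately show ?thesis by simp
  qed
  show ?case
  proof (rule ccontr)
    assume "\<not> ?thesis"
    then have lt: "d < a + b" by (simp add: a_def b_def d_def)
    have "a < d"
    proof (rule ccontr)
      assume "\<not> a < d"
      then have "h - p \<in> nonpos_cone h"
        using id ab by (intro cone_scale[OF p(1) q(1) diff_mem[OF L(1,2)] d0, of "a - d" b])
          (auto simp: algebra_simps)
      then have "p = h" using irr p(1) nz by blast
      then show False using p by simp
    qed
    have "b < d"
    proof (rule ccontr)
      assume "\<not> b < d"
      then have "h - q \<in> nonpos_cone h"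
        using id ab by (intro cone_scale[OF p(1) q(1) diff_mem[OF L(1,3)] d0, of a "b - d"])
          (auto simp: algebra_simps)
      then have "q = h" using irr q(1) nz by blast
      then show False using q by simp
    qed
    \<comment> \<open>The reflection of \<open>h\<close> in the centre of the parallelogram.\<close>
    define x where "x = p + q - h"
    have xL: "x \<in> L" unfolding x_def using L add_mem diff_mem by blast
    have x: "x \<in> nonpos_cone h"
      using id \<open>a < d\<close> \<open>b < d\<close>
      by (intro cone_scale[OF p(1) q(1) xL d0, of "d - a" "d - b"])
        (auto simp: algebra_simps x_def)
    have mx: "minor r s h x = a - b" "minor r s x h = b - a"
        "minor r s p x = d - b" "minor r s x q = d - a"
      using minor_commute[of r s h p] minor_commute[of r s q h]
      by (auto simp: x_def a_def b_def d_def)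
    consider "b < a" | "a < b" | "a = b" by linarith
    then show False
    proof cases
      case 1
      then have "minor r s h x + minor r s p h \<le> minor r s p x"
        using less.hyps[OF _ p x] mx \<open>b < d\<close> ab d0 by (simp flip: d_def)
      then show False using mx lt by (simp flip: b_def)
    next
      case 2
      then have "minor r s h q + minor r s x h \<le> minor r s x q"
        using less.hyps[OF _ x _ q] mx \<open>a < d\<close> ab d0 by (simp flip: d_def)
      then show False using mx lt by (simp flip: a_def)
    next
      case 3
      \<comment> \<open>Now \<open>x\<close> is a multiple of \<open>h\<close> by a factor strictly between zero and one.\<close>
      have ax: "a * x $ i = (d - a) * h $ i" for i
        using id[of i] 3 by (simp add: x_def algebra_simps)
      have "h - x \<in> nonpos_cone h"
      proof (rule cone_scale[OF hK hK diff_mem[OF L(1) xL] ab(1), of "2 * a - d" 0])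
        show "a * (h - x) $ i = (2 * a - d) * h $ i + 0 * h $ i" for i
          using ax[of i] unfolding vector_minus_component by algebra
      qed (use 3 lt in simp_all)
      then consider "x = 0" | "x = h" using irr x by blast
      then show False
      proof cases
        case 1
        then show ?thesis using ax \<open>a < d\<close> has_neg[OF L(1) graver_nonzero[OF h]] by auto
      next
        case 2
        obtain i where i: "h $ i < 0" using has_neg[OF L(1) graver_nonzero[OF h]] by blast
        show ?thesis using ax[of i] i lt \<open>a = b\<close> 2 by auto
      qed
    qed
  qed
qed

end

section \<open>Vectors of a basis common to all monomial orders\<close>

text \<open>The properties of the reduced Groebner basis, with both signs, when it is the same for all monomial
  orders. A monomial order enters only through a set \<open>C\<close> of vectors that it makes positive.\<close>

locale common_basis = rank_two_lattice L for L :: "(int ^ 'n::finite) set" +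
  fixes M :: "(int ^ 'n) set"
  assumes M_graver: "M \<subseteq> graver"
    and M_finite: "finite M"
    and M_uminus: "g \<in> M \<Longrightarrow> - g \<in> M"
    and antichain: "\<lbrakk>g \<in> M; g' \<in> M; pos_part g \<le> pos_part g'\<rbrakk> \<Longrightarrow> g = g'"
    and has_reducer: "\<lbrakk>C \<subseteq> L; \<And>u v. \<lbrakk>u \<in> C; v \<in> C\<rbrakk> \<Longrightarrow> u + v \<in> C; 0 \<notin> C; h \<in> C\<rbrakk> \<Longrightarrow>
      \<exists>g \<in> M. pos_part g \<le> pos_part h \<and> - g \<notin> C"
begin

lemma M_in: "g \<in> M \<Longrightarrow> g \<in> L" and M_nonzero: "g \<in> M \<Longrightarrow> g \<noteq> 0"
  using M_graver graver_in graver_nonzero by blast+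

text \<open>The orders used below compare two linear functionals lexicographically. They may leave
  vectors undecided, whence the weak inequality in the conclusion.\<close>

lemma has_reducer_lex:
  fixes f1 f2 :: "int ^ 'n \<Rightarrow> int"
  assumes f1: "\<And>u v. f1 (u + v) = f1 u + f1 v" and f2: "\<And>u v. f2 (u + v) = f2 u + f2 v"
    and h: "h \<in> L" "0 < f1 h \<or> f1 h = 0 \<and> 0 < f2 h"
  shows "\<exists>g \<in> M. pos_part g \<le> pos_part h \<and> (0 < f1 g \<or> f1 g = 0 \<and> 0 \<le> f2 g)"
proof -
  define C where "C = {w \<in> L. 0 < f1 w \<or> f1 w = 0 \<and> 0 < f2 w}"
  have f0: "f1 0 = 0" "f2 0 = 0" using f1[of 0 0] f2[of 0 0] by auto
  have fm: "f1 (- u) = - f1 u" "f2 (- u) = - f2 u" for u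
    using f1[of u "- u"] f2[of u "- u"] f0 by auto
  have "u + v \<in> C" if "u \<in> C" "v \<in> C" for u v
    using that add_mem by (auto simp: C_def f1 f2)
  moreover have "C \<subseteq> L" "0 \<notin> C" "h \<in> C" using h by (auto simp: C_def f0)
  ultimately obtain g where g: "g \<in> M" "pos_part g \<le> pos_part h" "- g \<notin> C"
    using has_reducer by blast
  then have "0 < f1 g \<or> f1 g = 0 \<and> 0 \<le> f2 g"
    using uminus_mem[OF M_in] by (auto simp: C_def fm)
  then show ?thesis using g by blast
qed

text \<open>Make the left half-plane and the ray of \<open>h\<close> positive: a reducer of \<open>h\<close> can then only be parallel to \<open>h\<close>.\<close>

lemma reducers_on_one_side:
  assumes h: "h \<in> graver"
    and par: "\<And>g. \<lbrakk>g \<in> L; minor p q h g = 0\<rbrakk> \<Longrightarrow> \<exists>a b. 0 < a \<and> (\<forall>i. a * g $ i = b * h $ i)"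
    and side: "\<And>g. \<lbrakk>g \<in> M; pos_part g \<le> pos_part h\<rbrakk> \<Longrightarrow> minor p q h g \<le> 0"
  shows "h \<in> M"
proof -
  obtain i where i: "0 < h $ i" using has_pos h graver_in graver_nonzero by blast
  obtain g where g: "g \<in> M" "pos_part g \<le> pos_part h"
      "0 < minor p q h g \<or> minor p q h g = 0 \<and> 0 \<le> g $ i"
    using has_reducer_lex[of "minor p q h" "\<lambda>w. w $ i" h] graver_in[OF h] i by auto
  then have "minor p q h g = 0" using side by fastforce
  then obtain a b where "0 < a" "\<And>i. a * g $ i = b * h $ i" using par g M_in by meson
  then have "g = h" using parallel_below_eq[OF h M_in M_nonzero] g by blast
  then show ?thesis using g by simp
qed

text \<open>A reducer \<open>g\<close> to the left of \<open>h\<close> lies in the smaller cone there, and \<open>h - g\<close>, to the right, lies in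
  the smaller cone on that side; so both are conformal to \<open>h\<close>.\<close>

lemma mixed_cone:
  assumes h: "h \<in> graver"
    and par: "\<And>g. \<lbrakk>g \<in> L; minor p q h g = 0\<rbrakk> \<Longrightarrow> \<exists>a b. 0 < a \<and> (\<forall>i. a * g $ i = b * h $ i)"
    and left: "\<And>w. \<lbrakk>w \<in> nonpos_cone h; 0 < minor p q h w\<rbrakk> \<Longrightarrow> w \<in> nonneg_cone h"
    and right: "\<And>w. \<lbrakk>w \<in> nonneg_cone h; minor p q h w < 0\<rbrakk> \<Longrightarrow> w \<in> nonpos_cone h"
  shows "h \<in> M"
proof (rule reducers_on_one_side[OF h par])
  fix g assume g: "g \<in> M" "pos_part g \<le> pos_part h"
  show "minor p q h g \<le> 0"
  proof (rule ccontr)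
    assume "\<not> minor p q h g \<le> 0"
    then have m: "0 < minor p q h g" by simp
    have c: "g \<in> nonpos_cone h" "h - g \<in> nonneg_cone h"
      using pos_part_le_iff_cones[OF graver_in[OF h] M_in] g by auto
    then have "g \<in> nonneg_cone h" "h - g \<in> nonpos_cone h" using m left right by auto
    then have "g = 0 \<or> g = h" using graver_irreducible[OF h] c by blast
    then show False using m by auto
  qed
qed

text \<open>Here all lattice points of the smaller cone are conformal to \<open>h\<close>. The reducers of \<open>- h\<close>, with
  opposite sign, form the set \<open>F\<close> of the proof; \<open>h - f\<close> is a point of the cone for each of its elements \<open>f\<close>.\<close>

lemma nested_cone:
  assumes h: "h \<in> graver"
    and par: "\<And>g. \<lbrakk>g \<in> L; minor p q h g = 0\<rbrakk> \<Longrightarrow> \<exists>a b. 0 < a \<and> (\<forall>i. a * g $ i = b * h $ i)"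
    and nested: "nonpos_cone h \<subseteq> nonneg_cone h"
  shows "h \<in> M"
proof (rule ccontr)
  assume hM: "h \<notin> M"
  have hL: "h \<in> L" "h \<noteq> 0" using h graver_in graver_nonzero by auto
  have mh: "- h \<in> graver" using h by (rule graver_uminus)
  have hK: "h \<in> nonpos_cone h" using hL by (auto simp: nonpos_cone_def)
  have irr: "x = 0 \<or> x = h" if "x \<in> nonpos_cone h" "h - x \<in> nonpos_cone h" for x
    using graver_irreducible[OF h] that nested by blast
  define F where "F = {f \<in> M. neg_part f \<le> neg_part h}"
  have F: "f \<in> L" "f \<in> graver" "f \<in> nonneg_cone h" "h - f \<in> nonpos_cone h" if "f \<in> F" for f
    using that M_in M_graver neg_part_le_iff_cones[OF hL(1), of f] by (auto simp: F_def)
  have F0: "minor p q h f \<noteq> 0" if f: "f \<in> F" for f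
  proof
    assume "minor p q h f = 0"
    then obtain a b where "0 < a" "\<And>i. a * f $ i = b * h $ i" using par F(1)[OF f] by blast
    then have "- f = - h"
      using f F(1)[OF f] uminus_mem M_nonzero[of f]
      by (intro parallel_below_eq[OF mh, of "- f" a b]) (auto simp: F_def neg_part_eq)
    then show False using hM f by (auto simp: F_def)
  qed
  \<comment> \<open>The boundary property of \<open>h\<close>, for the points \<open>h - f1\<close> and \<open>h - f2\<close> of the cone.\<close>
  have cross: "0 \<le> minor p q f1 f2"
    if "f1 \<in> F" "f2 \<in> F" "0 < minor p q h f1" "minor p q h f2 < 0" for f1 f2
    using no_lattice_triangle[OF h nested F(4)[OF that(1)] _ F(4)[OF that(2)], of p q] that
      minor_commute[of p q f1 h] by simp
  define FL where "FL = {f \<in> F. 0 < minor p q h f}"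
  have FL: "FL \<noteq> {}"
  proof
    assume FL: "FL = {}"
    have "- h \<in> M"
    proof (rule reducers_on_one_side[OF mh])
      fix g assume g: "g \<in> L" "minor p q (- h) g = 0"
      then obtain a b where "0 < a" "\<forall>i. a * g $ i = b * h $ i" using par[of g] by auto
      then have "0 < a \<and> (\<forall>i. a * g $ i = (- b) * (- h) $ i)" by simp
      then show "\<exists>a b. 0 < a \<and> (\<forall>i. a * g $ i = b * (- h) $ i)" by blast
    next
      fix g assume g: "g \<in> M" "pos_part g \<le> pos_part (- h)"
      then have "- g \<in> F" using M_uminus by (simp add: F_def neg_part_eq)
      then show "minor p q (- h) g \<le> 0" using FL by (force simp: FL_def)
    qed
    then show False using M_uminus hM by force
  qed
  \<comment> \<open>The line through \<open>e\<close>, the element of \<open>FL\<close> closest in direction to \<open>h\<close>, has \<open>F\<close> on the closed side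
    opposite to \<open>h\<close>.\<close>
  have "finite FL" using M_finite by (simp add: FL_def F_def)
  then obtain e where e: "e \<in> FL" and emin: "\<And>f. f \<in> FL \<Longrightarrow> 0 \<le> minor p q e f"
    using angular_minimum[OF _ FL, of p q h] unfolding FL_def by blast
  have eF: "e \<in> F" and he: "0 < minor p q h e" using e by (auto simp: FL_def)
  have below: "minor p q f e \<le> 0" if f: "f \<in> F" for f
    using f F0[OF f] emin[of f] cross[OF eF f he] minor_commute[of p q f e]
    by (cases "0 < minor p q h f") (auto simp: FL_def)
  have opposite: "g = - e" if g: "g \<in> graver" "minor p q g e = 0" "minor p q h g < 0" for g
  proof -
    have "minor p q h e * (- g) $ i = (- minor p q h g) * e $ i" for i
      using minors[OF hL(1) graver_in[OF g(1)] F(1)[OF eF], of p q i] g(2)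
        minor_commute[of p q e h] by simp
    then have "- g = e"
      using graver_parallel_eq[OF graver_uminus[OF g(1)] F(2)[OF eF], of "minor p q h e" "- minor p q h g"]
        he g(3) by simp
    then show ?thesis by auto
  qed
  \<comment> \<open>The order makes the side of \<open>- h\<close> positive and, on the line through \<open>e\<close>, the direction of \<open>e\<close>.
    The reducers of \<open>- h\<close> are the negatives of the elements of \<open>F\<close>, so they are on the line or on the side of \<open>h\<close>.
    The one provided by this order can only be \<open>e\<close>.\<close>
  have meF: "- e \<in> F"
  proof -
    obtain g where g: "g \<in> M" "pos_part g \<le> pos_part (- h)"
      "0 < minor p q e g \<or> minor p q e g = 0 \<and> 0 \<le> minor p q h g"
      using has_reducer_lex[of "minor p q e" "minor p q h" "- h"] uminus_mem[OF hL(1)] he minor_commute[of p q e h]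
      by auto
    have mgF: "- g \<in> F" using g M_uminus by (simp add: F_def neg_part_eq)
    have "minor p q g e \<ge> 0" using below[OF mgF] by simp
    then have "minor p q g e = 0" "0 \<le> minor p q h g"
      using g(3) minor_commute[of p q e g] by auto
    then have "- g = - e"
      using opposite[of "- g"] F(2)[OF mgF] F0[OF mgF] by simp
    then show ?thesis using mgF by simp
  qed
  \<comment> \<open>Since \<open>h - e\<close> and \<open>h + e\<close> belong to the cone, the boundary property of \<open>h\<close> with one of these points
    shows that the line through them supports the hull.\<close>
  have support: "minor p q h e \<le> minor p q w e" if w: "w \<in> nonpos_cone h" "w \<noteq> 0" for w
  proof -
    have wL: "w \<in> L" using w by (simp add: nonpos_cone_def)
    have P: "h - e \<in> nonpos_cone h" "h + e \<in> nonpos_cone h"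
      using F(4)[OF eF] F(4)[OF meF] by auto
    consider "0 < minor p q h w" | "minor p q h w < 0" | "minor p q h w = 0" by linarith
    then show ?thesis
    proof cases
      case 1
      then show ?thesis
        using no_lattice_triangle[OF h nested P(1) _ w(1), of p q] he
          minor_commute[of p q e h] minor_commute[of p q e w] by simp
    next
      case 2
      then show ?thesis
        using no_lattice_triangle[OF h nested w(1) _ P(2), of p q] he
          minor_commute[of p q w h] by simp
    next
      case 3
      then obtain a b where ab: "0 < a" "\<And>i. a * w $ i = b * h $ i" using par[OF wL] by blast
      obtain i where i: "h $ i < 0" using has_neg[OF hL] by blast
      then have "w $ i \<le> 0" using w by (simp add: nonpos_cone_def)
      then have "a * w $ i \<le> 0" using ab(1) by (simp add: mult_nonneg_nonpos)
      then have b0: "0 \<le> b" using i ab by (auto simp: mult_le_0_iff)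
      have "a \<le> b"
      proof (rule ccontr)
        assume "\<not> a \<le> b"
        then have "h - w \<in> nonpos_cone h"
          using ab by (intro cone_scale[OF hK hK diff_mem[OF hL(1) wL] ab(1), of "a - b" 0])
            (auto simp: algebra_simps)
        then have "w = h" using irr w by blast
        then show False using ab(2)[of i] i \<open>\<not> a \<le> b\<close> by simp
      qed
      then have "a * minor p q h e \<le> b * minor p q h e" using he by simp
      also have "\<dots> = a * minor p q w e" using minor_parallel[OF ab(2)] by simp
      finally show ?thesis using ab by simp
    qed
  qed
  \<comment> \<open>The end \<open>v = h - k e\<close> of the edge exists, because \<open>e\<close> has a negative coordinate,
    and \<open>h\<close> is negative there too.\<close>
  obtain k :: nat where k: "h - (\<chi> i. int k * e $ i) \<in> nonpos_cone h"
    "h - (\<chi> i. int (Suc k) * e $ i) \<notin> nonpos_cone h"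
  proof -
    let ?P = "\<lambda>k::nat. h - (\<chi> i. int k * e $ i) \<notin> nonpos_cone h"
    obtain i where i: "e $ i < 0" using has_neg F(1)[OF eF] eF M_nonzero by (auto simp: F_def)
    have "0 \<le> h $ i \<longrightarrow> 0 \<le> e $ i" using F(3)[OF eF] by (simp add: nonneg_cone_def)
    then have hi: "h $ i < 0" using i by linarith
    have "int (nat (1 - h $ i)) * e $ i \<le> int (nat (1 - h $ i)) * (- 1)"
      using i by (intro mult_left_mono) auto
    then have "0 < (h - (\<chi> j. int (nat (1 - h $ i)) * e $ j)) $ i" using hi by simp
    moreover have "w $ i \<le> 0" if "w \<in> nonpos_cone h" for w
      using that hi by (simp add: nonpos_cone_def)
    ultimately have "?P (nat (1 - h $ i))" by (meson not_le)
    moreover have "\<not> ?P 0" using hK by (simp add: vec_eq_iff[of "h - _" h] zero_vec_def[symmetric])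
    ultimately obtain k where "?P (Suc k)" "\<not> ?P k"
      using ex_least_nat_less[of ?P] by blast
    then show ?thesis using that by blast
  qed
  define v where "v = h - (\<chi> i. int k * e $ i)"
  have vi: "v $ i = h $ i - int k * e $ i" for i by (simp add: v_def)
  have v: "v \<in> nonpos_cone h" using k by (simp add: v_def)
  have vL: "v \<in> L" using v by (simp add: nonpos_cone_def)
  have ve: "v - e \<notin> nonpos_cone h"
  proof -
    have "v - e = h - (\<chi> i. int (Suc k) * e $ i)" by (simp add: vec_eq_iff vi algebra_simps)
    then show ?thesis using k by simp
  qed
  have mv: "minor p q v e = minor p q h e" unfolding minor_def vi by algebra
  \<comment> \<open>The tie-break declares \<open>- e\<close> positive. Of the two vectors of \<open>M\<close> along the edge only \<open>- e\<close> could
    then reduce \<open>- v\<close>, but \<open>v - e\<close> has left the cone.\<close>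
  obtain g where g: "g \<in> M" "pos_part g \<le> pos_part (- v)"
    "0 < minor p q e g \<or> minor p q e g = 0 \<and> 0 \<le> - minor p q h g"
    using has_reducer_lex[of "minor p q e" "\<lambda>w. - minor p q h w" "- v"] uminus_mem[OF vL] he mv
      minor_commute[of p q e v] by auto
  have gL: "g \<in> L" using g M_in by blast
  have gv: "g $ i \<le> - v $ i" if "h $ i \<le> 0" for i
    using that g(2) v unfolding pos_part_le_iff nonpos_cone_def by (auto simp: max_def split: if_splits)
  have vg: "v + g \<in> nonpos_cone h"
    using add_mem[OF vL gL] gv by (fastforce simp: nonpos_cone_def)
  show False
  proof (cases "v + g = 0")
    case True
    then have "g = - v" by (simp add: eq_neg_iff_add_eq_0 add.commute)
    have "pos_part e \<le> pos_part (- v)"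
      unfolding pos_part_le_iff
    proof
      fix i
      have "e $ i \<le> max 0 (- h $ i)" using meF by (auto simp: F_def neg_part_eq pos_part_le_iff)
      moreover have "0 \<le> int k * e $ i \<or> e $ i < 0" by (cases "0 \<le> e $ i") simp_all
      ultimately show "e $ i \<le> max 0 ((- v) $ i)" unfolding vector_uminus_component vi by linarith
    qed
    then have "e = - v" using antichain g(1) eF \<open>g = - v\<close> by (auto simp: F_def)
    then show False using mv he by (metis minor_simps(5,7) less_irrefl neg_0_equal_iff_equal minor_commute)
  next
    case False
    then have "minor p q h e \<le> minor p q (v + g) e" using support vg by blast
    then have "0 \<le> minor p q g e" using mv by simp
    then have g0: "minor p q g e = 0" "minor p q h g \<le> 0"
      using g(3) minor_commute[of p q e g] by auto
    have "minor p q h g \<noteq> 0"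
    proof
      assume "minor p q h g = 0"
      then have "minor p q h e * g $ i = 0" for i
        using minors[OF hL(1) gL F(1)[OF eF], of p q i] g0 minor_commute[of p q e h] by simp
      then have "g = 0" using he by (simp add: vec_eq_iff)
      then show False using M_nonzero g by blast
    qed
    then have "g = - e" using opposite g(1) g0 M_graver by auto
    then have "v - e \<in> nonpos_cone h" using vg by simp
    then show False using ve by simp
  qed
qed

text \<open>For a suitable choice of \<open>p\<close> and \<open>q\<close> the minor vanishes on the multiples of \<open>h\<close> only; when all vectors of
  the lattice are parallel to \<open>h\<close>, any choice will do. The nesting on the two sides then leaves four cases.\<close>

theorem graver_subset: "graver \<subseteq> M"
proof
  fix h assume h: "h \<in> graver"
  have hL: "h \<in> L" "h \<noteq> 0" using h graver_in graver_nonzero by auto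
  obtain p q where par:
    "\<And>g. \<lbrakk>g \<in> L; minor p q h g = 0\<rbrakk> \<Longrightarrow> \<exists>a b. 0 < a \<and> (\<forall>i. a * g $ i = b * h $ i)"
  proof (cases "\<exists>p q. \<exists>w \<in> L. minor p q h w \<noteq> 0")
    case True
    then obtain p q w where w: "w \<in> L" "minor p q h w \<noteq> 0" by blast
    have "\<exists>a b. 0 < a \<and> (\<forall>i. a * g $ i = b * h $ i)" if g: "g \<in> L" "minor p q h g = 0" for g
    proof -
      let ?c = "minor p q h w"
      have *: "?c * g $ i = - minor p q w g * h $ i" for i
        using minors[OF hL(1) w(1) g(1), of p q i] g(2) minor_commute[of p q g h]
        by (simp add: algebra_simps)
      have "\<bar>?c\<bar> * g $ i = (- sgn ?c * minor p q w g) * h $ i" for i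
      proof -
        have "\<bar>?c\<bar> * g $ i = sgn ?c * (?c * g $ i)" 
          by (cases "?c" "0::int" rule: linorder_cases) simp_all
        then show ?thesis unfolding * by simp
      qed
      then show ?thesis using w(2) by (metis zero_less_abs_iff)
    qed
    then show ?thesis using that by blast
  next
    case False
    obtain p where p: "0 < h $ p" using has_pos hL by blast
    have "\<exists>a b. 0 < a \<and> (\<forall>i. a * g $ i = b * h $ i)" if g: "g \<in> L" for g
    proof -
      have "h $ p * g $ i = g $ p * h $ i" for i
        using False g by (force simp: minor_def)
      then show ?thesis using p by blast
    qed
    then show ?thesis using that by blast
  qed
  have par': "\<exists>a b. 0 < a \<and> (\<forall>i. a * g $ i = b * h $ i)" if "g \<in> L" "minor q p h g = 0" for g
    using par that by (simp add: minor_swap[of q p])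
  have parn: "\<exists>a b. 0 < a \<and> (\<forall>i. a * g $ i = b * (- h) $ i)" if g: "g \<in> L" "minor p q (- h) g = 0" for g
  proof -
    obtain a b where "0 < a" "\<forall>i. a * g $ i = b * h $ i" using par[of g] g by auto
    then have "0 < a \<and> (\<forall>i. a * g $ i = (- b) * (- h) $ i)" by simp
    then show ?thesis by blast
  qed
  obtain i where i: "h $ i < 0" using has_neg hL by blast
  obtain j where j: "0 < h $ j" using has_pos hL by blast
  have line: "w \<in> nonpos_cone h \<longleftrightarrow> w \<in> nonneg_cone h" if w: "w \<in> L" "minor p q h w = 0" for w
  proof -
    obtain a b where a: "0 < a" and ab: "\<And>i. a * w $ i = b * h $ i" using par[OF w] by blast
    have sgn: "w $ i \<le> 0 \<longleftrightarrow> b * h $ i \<le> 0" "0 \<le> w $ i \<longleftrightarrow> 0 \<le> b * h $ i" for i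
      using a by (simp_all flip: ab add: mult_le_0_iff zero_le_mult_iff)
    have "w \<in> nonpos_cone h \<longleftrightarrow> 0 \<le> b"
    proof
      assume "w \<in> nonpos_cone h"
      then have "b * h $ i \<le> 0" using i sgn by (simp add: nonpos_cone_def)
      then show "0 \<le> b" using i by (simp add: mult_le_0_iff)
    qed (simp add: nonpos_cone_def sgn w mult_nonneg_nonpos)
    moreover have "w \<in> nonneg_cone h \<longleftrightarrow> 0 \<le> b"
    proof
      assume "w \<in> nonneg_cone h"
      then have "0 \<le> b * h $ j" using j sgn by (simp add: nonneg_cone_def)
      then show "0 \<le> b" using j by (simp add: zero_le_mult_iff)
    qed (simp add: nonneg_cone_def sgn w)
    ultimately show ?thesis by simp
  qed
  consider
      "\<forall>w \<in> nonpos_cone h. 0 < minor p q h w \<longrightarrow> w \<in> nonneg_cone h"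
      "\<forall>w \<in> nonpos_cone h. minor p q h w < 0 \<longrightarrow> w \<in> nonneg_cone h"
    | "\<forall>w \<in> nonneg_cone h. 0 < minor p q h w \<longrightarrow> w \<in> nonpos_cone h"
      "\<forall>w \<in> nonneg_cone h. minor p q h w < 0 \<longrightarrow> w \<in> nonpos_cone h"
    | "\<forall>w \<in> nonpos_cone h. 0 < minor p q h w \<longrightarrow> w \<in> nonneg_cone h"
      "\<forall>w \<in> nonneg_cone h. minor p q h w < 0 \<longrightarrow> w \<in> nonpos_cone h"
    | "\<forall>w \<in> nonneg_cone h. 0 < minor p q h w \<longrightarrow> w \<in> nonpos_cone h"
      "\<forall>w \<in> nonpos_cone h. minor p q h w < 0 \<longrightarrow> w \<in> nonneg_cone h"
    using cones_nested[OF hL(1), of p q] cones_nested[OF hL(1), of q p]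
    unfolding minor_swap[of q p] neg_0_less_iff_less by blast
  then show "h \<in> M"
  proof cases
    case 1
    have "nonpos_cone h \<subseteq> nonneg_cone h"
    proof
      fix w assume w: "w \<in> nonpos_cone h"
      then have "w \<in> L" by (simp add: nonpos_cone_def)
      then show "w \<in> nonneg_cone h" using w 1 line[of w]
        by (meson linorder_neqE)
    qed
    then show ?thesis using nested_cone[OF h par] by blast
  next
    case 2
    have *: "nonneg_cone h \<subseteq> nonpos_cone h"
    proof
      fix w assume w: "w \<in> nonneg_cone h"
      then have "w \<in> L" by (simp add: nonneg_cone_def)
      then show "w \<in> nonpos_cone h" using w 2 line[of w]
        by (meson linorder_neqE)
    qed
    have "nonpos_cone (- h) \<subseteq> nonneg_cone (- h)"
    proof
      fix w assume "w \<in> nonpos_cone (- h)"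
      then have "- w \<in> nonneg_cone h" using uminus_mem by (auto simp: nonpos_cone_def nonneg_cone_def)
      then have "- w \<in> nonpos_cone h" using * by blast
      then show "w \<in> nonneg_cone (- h)" using uminus_mem[of "- w"] by (auto simp: nonpos_cone_def nonneg_cone_def)
    qed
    then have "- h \<in> M" using nested_cone[OF graver_uminus[OF h] parn] by blast
    then show ?thesis using M_uminus by force
  next
    case 3
    then show ?thesis using mixed_cone[OF h par] by blast
  next
    case 4
    show ?thesis
    proof (rule mixed_cone[OF h par'])
      show "w \<in> nonneg_cone h" if "w \<in> nonpos_cone h" "0 < minor q p h w" for w
        using 4 that by (simp add: minor_swap[of q p])
      show "w \<in> nonpos_cone h" if "w \<in> nonneg_cone h" "minor q p h w < 0" for w
        using 4 that by (simp add: minor_swap[of q p])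
    qed
  qed
qed

end

section \<open>Robust and strongly robust toric ideals of codimension two\<close>

context rank_two_lattice
begin

text \<open>In an order that makes \<open>g\<close> positive, \<open>g\<^sup>+\<close> is a corner, whereas \<open>g'\<^sup>+\<close> is a corner or standard. If
  \<open>g\<^sup>+\<close> divides \<open>g'\<^sup>+\<close>, the latter is excluded and the two corners are equal. So no monomial of a
  vector of the common basis divides one of another.\<close>

lemma robust_imp_graver_universal:
  assumes rob: "robust (lattice_ideal :: ('n, 'k::field) mpoly set)" and u: "u \<in> graver"
  shows "u \<in> universal_vectors \<or> - u \<in> universal_vectors"
proof -
  define M where "M = {u. u \<in> universal_vectors \<or> - u \<in> universal_vectors}"
  have red: "g \<in> ordered_lattice.reduced_vectors L r \<or> - g \<in> ordered_lattice.reduced_vectors L r"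
    if "monomial_order r" "g \<in> M" for g r
    using robust_reduced_vectors[OF rob that(1)] that(2) unfolding M_def
    by (metis (mono_tags, lifting) add.inverse_inverse mem_Collect_eq)
  have MG: "M \<subseteq> graver"
    unfolding M_def using universal_vectors_graver graver_uminus
    by (metis (mono_tags, lifting) add.inverse_inverse mem_Collect_eq subsetD subsetI)
  interpret common_basis L M
  proof
    show "M \<subseteq> graver" by (rule MG)
    show "- g \<in> M" if "g \<in> M" for g using that by (auto simp: M_def)
    show "finite M"
    proof -
      obtain r :: "(nat ^ 'n) rel" where r: "monomial_order r" using exists_monomial_order[of "{}"] by auto
      let ?R = "ordered_lattice.reduced_vectors L r"
      have "M \<subseteq> ?R \<union> uminus ` ?R"
      proof
        fix g assume "g \<in> M"
        then have "g \<in> ?R \<or> - g \<in> ?R" by (rule red[OF r])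
        then show "g \<in> ?R \<union> uminus ` ?R" by (metis Un_iff add.inverse_inverse imageI)
      qed
      moreover have "finite ?R" using ordered_lattice.finite_reduced_vectors ordered_lattice[OF r] by blast
      ultimately show ?thesis by (meson finite_UnI finite_imageI finite_subset)
    qed
    show "g = g'" if g: "g \<in> M" "g' \<in> M" "pos_part g \<le> pos_part g'" for g g'
    proof -
      \<comment> \<open>The set \<open>C\<close> of positive multiples of \<open>g\<close> serves only to choose an order in which \<open>g\<close> is positive.\<close>
      define C where "C = {(\<chi> i. int (Suc k) * g $ i) | k. True}"
      have gL: "g \<in> L" "g \<noteq> 0" using g MG graver_in graver_nonzero by auto
      have gC: "g \<in> C"
      proof -
        have "g = (\<chi> i. int (Suc 0) * g $ i)" by (simp add: vec_eq_iff)
        then show ?thesis unfolding C_def by blast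
      qed
      have "(\<chi> i. int (Suc k) * g $ i) \<in> L" for k
      proof (induction k)
        case 0
        then show ?case using gL by simp
      next
        case (Suc k)
        have "(\<chi> i. int (Suc (Suc k)) * g $ i) = g + (\<chi> i. int (Suc k) * g $ i)"
          by (simp add: vec_eq_iff distrib_right)
        then show ?case using add_mem[OF gL(1) Suc] by metis
      qed
      then have "C \<subseteq> L" by (auto simp: C_def)
      moreover have "x + y \<in> C" if xy: "x \<in> C" "y \<in> C" for x y
      proof -
        obtain k l where "x = (\<chi> i. int (Suc k) * g $ i)" "y = (\<chi> i. int (Suc l) * g $ i)"
          using xy unfolding C_def by blast
        then have "x + y = (\<chi> i. int (Suc (k + l + 1)) * g $ i)"
          by (simp add: vec_eq_iff distrib_right)
        then show ?thesis unfolding C_def by blast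
      qed
      moreover have "0 \<notin> C"
      proof
        assume "0 \<in> C"
        then obtain k where k: "0 = (\<chi> i. int (Suc k) * g $ i)" unfolding C_def by blast
        have "g $ i = 0" for i using arg_cong[OF k, of "\<lambda>v. v $ i"] by simp
        then show False using gL(2) by (simp add: vec_eq_iff)
      qed
      ultimately obtain r where r: "monomial_order r" "\<forall>x \<in> C. (neg_part x, pos_part x) \<in> r"
        using exists_monomial_order[of C] by blast
      interpret ordered_lattice L r using r(1) by (rule ordered_lattice)
      have pos: "x \<in> reduced_vectors \<or> x \<noteq> g" if x: "x \<in> M" for x
      proof -
        have "- g \<notin> reduced_vectors"
        proof
          assume "- g \<in> reduced_vectors"
          then have "(pos_part g, neg_part g) \<in> r" using reducedD(6)[of "- g"] by (simp add: neg_part_eq)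
          moreover have "(neg_part g, pos_part g) \<in> r" using r(2) gC by blast
          ultimately show False using parts_neq[OF gL(2)] r_antisym by blast
        qed
        then show ?thesis using red[OF r(1) x] by blast
      qed
      then have gR: "g \<in> reduced_vectors" using g(1) by blast
      consider "g' \<in> reduced_vectors" | "- g' \<in> reduced_vectors" using red[OF r(1) g(2)] by blast
      then show ?thesis
      proof cases
        case 1
        then show ?thesis using reduced_vectors_antichain gR g(3) by blast
      next
        case 2
        then have "standard (pos_part g')" using reducedD(3)[of "- g'"] by (simp add: neg_part_eq)
        then show ?thesis using standard_le[OF g(3)] reducedD(4)[OF gR] by blast
      qed
    qed
    show "\<exists>g \<in> M. pos_part g \<le> pos_part h \<and> - g \<notin> C"
      if C: "C \<subseteq> L" "\<And>u v. u \<in> C \<Longrightarrow> v \<in> C \<Longrightarrow> u + v \<in> C" "0 \<notin> C" "h \<in> C" for C h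
    proof -
      obtain r where r: "monomial_order r" "\<forall>x \<in> C. (neg_part x, pos_part x) \<in> r"
        using exists_monomial_order[of C] C by blast
      interpret ordered_lattice L r using r(1) by (rule ordered_lattice)
      have "h \<in> L" "h \<noteq> 0" "(neg_part h, pos_part h) \<in> r" using C r by auto
      then obtain g where g: "g \<in> reduced_vectors" "pos_part g \<le> pos_part h" using reducer by blast
      have "- g \<notin> C"
      proof
        assume "- g \<in> C"
        then have "(neg_part (- g), pos_part (- g)) \<in> r" using r(2) by blast
        then have "(pos_part g, neg_part g) \<in> r" by (simp add: neg_part_eq)
        then show False using reducedD(6)[OF g(1)] parts_neq[OF reducedD(5)[OF g(1)]] r_antisym by blast
      qed
      moreover have "g \<in> M" using reduced_vectors_universal[OF r(1)] g(1) by (auto simp: M_def)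
      ultimately show ?thesis using g(2) by blast
    qed
  qed
  show ?thesis using graver_subset u by (auto simp: M_def)
qed

lemma robust_iff_strongly_robust:
  "robust (lattice_ideal :: ('n, 'k::field) mpoly set) \<longleftrightarrow>
    strongly_robust (lattice_ideal :: ('n, 'k) mpoly set)"
proof
  assume rob: "robust (lattice_ideal :: ('n, 'k) mpoly set)"
  let ?cls = "\<lambda>u. {binom u, - binom u :: ('n, 'k) mpoly}"
  have "?cls u \<in> ?cls ` universal_vectors" if "u \<in> graver" for u
  proof -
    have "u \<in> universal_vectors \<or> - u \<in> universal_vectors"
      using robust_imp_graver_universal[OF rob that] .
    moreover have "?cls u = ?cls (- u)" by (auto simp: binom_uminus)
    ultimately show ?thesis by blast
  qed
  then have "?cls ` graver = ?cls ` universal_vectors" using universal_vectors_graver by blast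
  then show "strongly_robust (lattice_ideal :: ('n, 'k) mpoly set)"
    using rob unfolding strongly_robust_def robust_def graver_basis_eq universal_groebner_basis_eq
      up_to_sign_binom by simp
qed (rule strongly_robust_imp_robust)

end

text \<open>Three vectors with a nonzero minor would be independent in a kernel of dimension two.\<close>

lemma minors_of_corank_two:
  fixes A :: "real ^ 'n::finite ^ 'm::finite"
  assumes rk: "rank A + 2 = CARD('n)" and ker: "A *v u = 0" "A *v v = 0" "A *v w = 0"
  shows "(v $ p * w $ q - v $ q * w $ p) * u $ i + (w $ p * u $ q - w $ q * u $ p) * v $ i +
    (u $ p * v $ q - u $ q * v $ p) * w $ i = 0" (is "?D = 0")
proof (rule ccontr)
  assume D: "?D \<noteq> 0"
  have w0: "w \<noteq> 0" using D by auto
  have vw: "v \<notin> span {w}"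
  proof
    assume "v \<in> span {w}"
    then obtain c where "v = c *\<^sub>R w" unfolding span_singleton by blast
    then have v: "v $ j = c * w $ j" for j by simp
    have "?D = 0" unfolding v by algebra
    then show False using D by simp
  qed
  have uvw: "u \<notin> span {v, w}"
  proof
    assume "u \<in> span {v, w}"
    then obtain b c where "u = b *\<^sub>R v + c *\<^sub>R w"
      unfolding span_insert span_singleton by (auto simp: algebra_simps)
    then have u: "u $ j = b * v $ j + c * w $ j" for j by simp
    have "?D = 0" unfolding u by algebra
    then show False using D by simp
  qed
  have ind: "independent {u, v, w}"
    using w0 vw uvw by (simp add: independent_insert)
  have card: "card {u, v, w} = 3"
    using vw uvw by (metis card_3_iff insertI1 insertI2 span_base)
  have "{u, v, w} \<subseteq> {x. A *v x = 0}" using ker by simp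
  then have "3 \<le> dim {x. A *v x = 0}" using independent_card_le_dim[OF _ ind] card by simp
  moreover have "dim {x. A *v x = 0} + rank A \<le> CARD('n)"
  proof -
    have "dim {x. A *v x = 0} + dim (rows A) = dim ({x. A *v x = 0} \<union> rows A)"
      using orthogonal_nullspace_rowspace[of A] span_base
      by (intro dim_orthogonal_sum[symmetric]) (auto simp: orthogonal_def)
    also have "\<dots> \<le> CARD('n)" by (rule dim_subset_UNIV_cart)
    finally show ?thesis by (simp add: row_rank_def)
  qed
  ultimately show False using rk by simp
qed


theorem theorem4p5:
  fixes A :: "int ^ 'n::finite ^ 'm::finite"
  assumes "int_kernel A \<inter> {u. \<forall>i. 0 \<le> u $ i} = {0}"
    and "rank (map_matrix real_of_int A) + 2 = CARD('n)"
  shows "robust (toric_ideal A :: ('n, 'k::field) mpoly set)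
     \<longleftrightarrow> strongly_robust (toric_ideal A :: ('n, 'k) mpoly set)"
proof -
  let ?R = "\<lambda>u :: int ^ 'n. (\<chi> i. real_of_int (u $ i))"
  interpret rank_two_lattice "int_kernel A"
  proof
    show "0 \<in> int_kernel A" by (simp add: int_kernel_def)
    show "u + v \<in> int_kernel A" if "u \<in> int_kernel A" "v \<in> int_kernel A" for u v
      using that by (simp add: int_kernel_def matrix_vector_right_distrib)
    show "- u \<in> int_kernel A" if "u \<in> int_kernel A" for u
      using that by (simp add: int_kernel_def vec_eq_iff matrix_vector_mult_def sum_negf)
    show "u = 0" if "u \<in> int_kernel A" "\<forall>i. 0 \<le> u $ i" for u
      using assms(1) that by blast
    fix u v w p q i
    assume uvw: "u \<in> int_kernel A" "v \<in> int_kernel A" "w \<in> int_kernel A"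
    have ker: "map_matrix real_of_int A *v ?R x = 0" if "x \<in> int_kernel A" for x
    proof -
      have "(map_matrix real_of_int A *v ?R x) $ j = real_of_int ((A *v x) $ j)" for j
        by (simp add: matrix_vector_mult_def map_matrix_def)
      then show ?thesis using that by (simp add: int_kernel_def vec_eq_iff)
    qed
    have "real_of_int (minor p q v w * u $ i + minor p q w u * v $ i + minor p q u v * w $ i) = 0"
      using minors_of_corank_two[OF assms(2) ker[OF uvw(1)] ker[OF uvw(2)] ker[OF uvw(3)], of p q i]
      by (simp add: minor_def)
    then show "minor p q v w * u $ i + minor p q w u * v $ i + minor p q u v * w $ i = 0"
      by (simp only: of_int_eq_0_iff)
  qed
  show ?thesis using robust_iff_strongly_robust unfolding toric_ideal_def lattice_ideal_def .
qed

end
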